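(* Let $\mathcal{X},\mathcal{Y},\mathcal{Z},\hat{\mathcal{X}}$ be finite sets, $P_{X,Y,Z}$ a probability distribution on $\mathcal{X}\times\mathcal{Y}\times\mathcal{Z}$, $F:\mathcal{X}\times\mathcal{Y}\to\mathcal{F}$ a function, and $d:\mathcal{F}\times\hat{\mathcal{X}}\to[0,\infty)$ a distortion measure. Let $\mathcal{R}_{\text{eve}}$ be the rate-distortion-equivocation region, defined in the context, for end-user privacy at an eavesdropper (observing $W$ and $Z^n$) with memoryless reconstruction, i.e. $\hat{X}_i\sim p(\hat{x}_i|w,y_i)$ for $i=1,\dots,n$. Then $\mathcal{R}_{\text{eve}}$ equals the set $\mathcal{R}_{\text{in}}^{(\text{eve,causal})}$ of all $(R,D,\triangle)\in\mathbb{R}_+^3$ such that $$R\ge I(X;U),\qquad D\ge E[d(F(X,Y),\hat{X})],\qquad \triangle\le H(\hat{X}|U,Z),$$ for some random variables $(X,Y,Z,U,\hat{X})$, with $U\in\mathcal{U}$, $\hat{X}\in\hat{\mathcal{X}}$, whose joint distribution has the form $P_{X,Y,Z}(x,y,z)P_{U|X}(u|x)P_{\hat{X}|U,Y}(\hat{x}|u,y)$ with $|\mathcal{U}|\le|\mathcal{X}|+3$.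
   Context: $(X^n,Y^n,Z^n)$ denotes $n$-length sequences with $(X_i,Y_i,Z_i)$, $i=1,\dots,n$, i.i.d. according to $P_{X,Y,Z}$. The function $F^{(n)}(X^n,Y^n)$ is component-wise: its $i$-th component is $F(X_i,Y_i)$. The distortion is $d^{(n)}(F^{(n)}(X^n,Y^n),\hat{X}^n)=\frac1n\sum_{i=1}^n d(F(X_i,Y_i),\hat{X}_i)$. A $(|\mathcal{W}^{(n)}|,n)$-code with memoryless reconstruction consists of a finite set $\mathcal{W}^{(n)}$, a deterministic encoder $f^{(n)}:\mathcal{X}^n\to\mathcal{W}^{(n)}$, and a stochastic decoder that generates $\hat{X}^n\in\hat{\mathcal{X}}^n$ as follows: for each $i=1,\dots,n$, $\hat{X}_i$ is drawn according to a conditional distribution $p(\hat{x}_i|w,y_i)$ (which may depend on $i$), where $W=f^{(n)}(X^n)$; that is, given $(W,Y^n)=(w,y^n)$, $\hat{X}^n$ has distribution $\prod_{i=1}^n p(\hat{x}_i|w,y_i)$ and is conditionally independent of $(X^n,Z^n)$. A tuple $(R,D,\triangle)\in\mathbb{R}_+^3$ is achievable if for any $\delta>0$ and all sufficiently large $n$ there exists such a code with $\frac1n\log|\mathcal{W}^{(n)}|\le R+\delta$, $E[d^{(n)}(F^{(n)}(X^n,Y^n),\hat{X}^n)]\le D+\delta$, and $\frac1n H(\hat{X}^n|W,Z^n)\ge\triangle-\delta$. The region $\mathcal{R}_{\text{eve}}$ is the set of all achievable tuples. $H$ and $I$ denote Shannon entropy and mutual information (with the same logarithm base throughout), and $\mathbb{R}_+=[0,\infty)$.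 *)

theory Defs
  imports "HOL-Probability.Probability"
begin

text \<open>
  The finite alphabets are types of class finite; sequences of length n are lists.  The base b of
  the logarithm is a parameter.  Message sets and the range of the auxiliary variable U are finite
  sets of natural numbers, because their size is quantified inside the definitions.

  Entropies are the library's, on the probability space \<open>measure_pmf p\<close>.  The range of every random
  variable here is a countable type, for which the counting measure on UNIV is sigma-finite, as the
  library's lemmas on these notions require.
\<close>

definition mutual_info_pmf :: "real \<Rightarrow> 's pmf \<Rightarrow> ('s \<Rightarrow> 'a) \<Rightarrow> ('s \<Rightarrow> 'b) \<Rightarrow> real" where
  "mutual_info_pmf b p X Y =
     prob_space.mutual_information (measure_pmf p) b (count_space UNIV) (count_space UNIV) X Y"

definition cond_entropy_pmf :: "real \<Rightarrow> 's pmf \<Rightarrow> ('s \<Rightarrow> 'a) \<Rightarrow> ('s \<Rightarrow> 'b) \<Rightarrow> real" where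
  "cond_entropy_pmf b p X Y =
     prob_space.conditional_entropy (measure_pmf p) b (count_space UNIV) (count_space UNIV) X Y"

definition product_list_pmf :: "nat \<Rightarrow> (nat \<Rightarrow> 'a pmf) \<Rightarrow> 'a list pmf" where
  "product_list_pmf n q = map_pmf (\<lambda>h. map h [0..<n]) (Pi_pmf {..<n} undefined q)"

text \<open>
  A code consists of a message set, an encoder, and a decoder whose kernel \<open>dec i w y\<close> is the
  distribution of the i-th reconstruction symbol (positions are counted from 0).
\<close>

record ('x, 'y, 'r) code =
  msgs :: "nat set"
  enc :: "'x list \<Rightarrow> nat"
  dec :: "nat \<Rightarrow> nat \<Rightarrow> 'y \<Rightarrow> 'r pmf"

definition is_code :: "nat \<Rightarrow> ('x, 'y, 'r) code \<Rightarrow> bool" where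
  "is_code n c \<longleftrightarrow> finite (msgs c) \<and> enc c \<in> {xs. length xs = n} \<rightarrow> msgs c"

definition code_joint ::
  "('x \<times> 'y \<times> 'z) pmf \<Rightarrow> nat \<Rightarrow> ('x, 'y, 'r) code \<Rightarrow> ('x list \<times> 'y list \<times> 'z list \<times> nat \<times> 'r list) pmf"
  where
  "code_joint P n c =
     do {
       s \<leftarrow> replicate_pmf n P;
       let xs = map (\<lambda>(x, y, z). x) s;
       let ys = map (\<lambda>(x, y, z). y) s;
       let zs = map (\<lambda>(x, y, z). z) s;
       let w = enc c xs;
       rs \<leftarrow> product_list_pmf n (\<lambda>i. dec c i w (ys ! i));
       return_pmf (xs, ys, zs, w, rs)
     }"

definition distortion ::
  "('x \<Rightarrow> 'y \<Rightarrow> 'f) \<Rightarrow> ('f \<Rightarrow> 'r \<Rightarrow> real) \<Rightarrow> nat \<Rightarrow> 'x list \<Rightarrow> 'y list \<Rightarrow> 'r list \<Rightarrow> real" where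
  "distortion F d n xs ys rs = 1 / real n * (\<Sum>i<n. d (F (xs ! i) (ys ! i)) (rs ! i))"

definition code_distortion ::
  "('x \<times> 'y \<times> 'z) pmf \<Rightarrow> ('x \<Rightarrow> 'y \<Rightarrow> 'f) \<Rightarrow> ('f \<Rightarrow> 'r \<Rightarrow> real) \<Rightarrow> nat \<Rightarrow> ('x, 'y, 'r) code \<Rightarrow> real"
  where
  "code_distortion P F d n c =
     measure_pmf.expectation (code_joint P n c) (\<lambda>(xs, ys, zs, w, rs). distortion F d n xs ys rs)"

definition code_equivocation ::
  "real \<Rightarrow> ('x \<times> 'y \<times> 'z) pmf \<Rightarrow> nat \<Rightarrow> ('x, 'y, 'r) code \<Rightarrow> real" where
  "code_equivocation b P n c =
     1 / real n * cond_entropy_pmf b (code_joint P n c)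
       (\<lambda>(xs, ys, zs, w, rs). rs) (\<lambda>(xs, ys, zs, w, rs). (w, zs))"

definition achievable ::
  "real \<Rightarrow> ('x::finite \<times> 'y::finite \<times> 'z::finite) pmf \<Rightarrow> ('x \<Rightarrow> 'y \<Rightarrow> 'f) \<Rightarrow> ('f \<Rightarrow> 'r::finite \<Rightarrow> real)
    \<Rightarrow> real \<Rightarrow> real \<Rightarrow> real \<Rightarrow> bool" where
  "achievable b P F d R D \<Delta> \<longleftrightarrow>
     (\<forall>\<delta>>0. \<forall>\<^sub>F n in sequentially. \<exists>c :: ('x, 'y, 'r) code. is_code n c \<and>
        1 / real n * log b (real (card (msgs c))) \<le> R + \<delta> \<and>
        code_distortion P F d n c \<le> D + \<delta> \<and>
        code_equivocation b P n c \<ge> \<Delta> - \<delta>)"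

definition region_eve ::
  "real \<Rightarrow> ('x::finite \<times> 'y::finite \<times> 'z::finite) pmf \<Rightarrow> ('x \<Rightarrow> 'y \<Rightarrow> 'f) \<Rightarrow> ('f \<Rightarrow> 'r::finite \<Rightarrow> real)
    \<Rightarrow> (real \<times> real \<times> real) set" where
  "region_eve b P F d =
     {(R, D, \<Delta>). R \<ge> 0 \<and> D \<ge> 0 \<and> \<Delta> \<ge> 0 \<and> achievable b P F d R D \<Delta>}"

definition single_letter_joint ::
  "('x \<times> 'y \<times> 'z) pmf \<Rightarrow> ('x \<Rightarrow> nat pmf) \<Rightarrow> (nat \<Rightarrow> 'y \<Rightarrow> 'r pmf) \<Rightarrow> ('x \<times> 'y \<times> 'z \<times> nat \<times> 'r) pmf"
  where
  "single_letter_joint P PU PR =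
     do {
       (x, y, z) \<leftarrow> P;
       u \<leftarrow> PU x;
       r \<leftarrow> PR u y;
       return_pmf (x, y, z, u, r)
     }"

definition region_in_eve_causal ::
  "real \<Rightarrow> ('x::finite \<times> 'y::finite \<times> 'z::finite) pmf \<Rightarrow> ('x \<Rightarrow> 'y \<Rightarrow> 'f) \<Rightarrow> ('f \<Rightarrow> 'r::finite \<Rightarrow> real)
    \<Rightarrow> (real \<times> real \<times> real) set" where
  "region_in_eve_causal b P F d =
     {(R, D, \<Delta>). R \<ge> 0 \<and> D \<ge> 0 \<and> \<Delta> \<ge> 0 \<and>
        (\<exists>(U :: nat set) PU PR.
           finite U \<and> card U \<le> CARD('x) + 3 \<and> (\<forall>x. set_pmf (PU x) \<subseteq> U) \<and>
           (let J = single_letter_joint P PU PR in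
              R \<ge> mutual_info_pmf b J (\<lambda>(x, y, z, u, r). x) (\<lambda>(x, y, z, u, r). u) \<and>
              D \<ge> measure_pmf.expectation J (\<lambda>(x, y, z, u, r). d (F x y) r) \<and>
              \<Delta> \<le> cond_entropy_pmf b J (\<lambda>(x, y, z, u, r). r) (\<lambda>(x, y, z, u, r). (u, z))))}"

end

theory Submission
  imports Defs "HOL-Real_Asymp.Real_Asymp"
begin

text \<open>
  Write \<open>R\<close> for the reconstruction.  Converse: \<open>U\<^sub>i = W\<close> works at every position \<open>i\<close>.  Indeed \<open>R\<^sub>i\<close>
  depends on \<open>(W, Y\<^sub>i)\<close> only, \<open>log |W| \<ge> n H(X) - \<Sum>\<^sub>i H(X\<^sub>i | W)\<close>, and
  \<open>H(R\<^sup>n | W, Z\<^sup>n) \<le> \<Sum>\<^sub>i H(R\<^sub>i | W, Z\<^sub>i)\<close>.  Given \<open>U = u\<close>, a single-letter law contributes the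
  point \<open>(law of X, H(X), E[d], H(R | Z))\<close>; these points form a compact set that spans an affine
  space of dimension at most \<open>|X| + 2\<close>, so time sharing, the limit \<open>\<delta> \<rightarrow> 0\<close> and the cardinality
  bound all take place in its convex hull (Caratheodory).

  Achievability: a greedily chosen codebook of rate \<open>I(X; U)\<close> covers almost all of \<open>X\<^sup>n\<close> with
  jointly typical codewords.  Typicality is only asked for the information density and for two cost
  functions of \<open>(x, u)\<close>: the conditional mean of the distortion, and that of the logarithm of a
  ratio of single-letter probabilities whose sum over the positions, minus \<open>log |W|\<close>, is a lower
  bound of the equivocation.
\<close>

section \<open>Expectations and entropies of finitely supported distributions\<close>

text \<open>Mutual information is not linear in the law of U, but I(X;U) = H(X) - H(X|U), and H(X)
  is the same for every admissible joint law. Recording the law of X and H(X|U=u) instead makes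
  every coordinate an average over u, so a joint law is a convex combination of letter points. The
  coordinates of the law of X sum to 1, which lowers the dimension from |X| + 3 to |X| + 2;
  Caratheodory then allows |X| + 3 points.

  In achievability the equivocation is not the average of a single-letter cost, so typicality cannot
  control it directly. Cross entropies against product laws yield a lower bound that is such an
  average. It loses log |W|, while the single-letter mean exceeds H(R|U,Z) by I(X;U); hence the
  codebook is given a rate close to I(X;U) even where the allowed rate is larger. Against the exact
  conditional laws a cross entropy could be infinite, because a block without typical codeword can
  create pairs (x, u) of probability zero; the laws are therefore mixed with the uniform one. Only
  expectations are compared, so costs that involve (y, z, r) are first averaged given (x,
  u).\<close>

lemma expectation_map_pmf:
  fixes g :: "'b \<Rightarrow> real"
  shows "measure_pmf.expectation (map_pmf f p) g = measure_pmf.expectation p (\<lambda>x. g (f x))"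
  by (simp add: map_pmf_rep_eq integral_distr)

lemma expectation_bind_finite:
  fixes h :: "'b \<Rightarrow> real"
  assumes "finite (set_pmf p)" and "\<And>x. x \<in> set_pmf p \<Longrightarrow> finite (set_pmf (f x))"
  shows "measure_pmf.expectation (bind_pmf p f) h
           = measure_pmf.expectation p (\<lambda>x. measure_pmf.expectation (f x) h)"
proof -
  \<comment> \<open>The library rule wants finite support of the kernel at every point, so
    \<open>f\<close> is altered off the support of \<open>p\<close>, where it does not affect the
    result.\<close>
  define f' where "f' = (\<lambda>x. if x \<in> set_pmf p then f x else return_pmf undefined)"
  have "bind_pmf p f = bind_pmf p f'"
    by (intro bind_pmf_cong) (auto simp: f'_def)
  also have "measure_pmf.expectation \<dots> h
      = (\<Sum>a\<in>set_pmf p. pmf p a *\<^sub>R measure_pmf.expectation (f' a) h)"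
    using assms by (intro pmf_expectation_bind) (auto simp: f'_def)
  also have "\<dots> = (\<Sum>a\<in>set_pmf p. measure_pmf.expectation (f a) h * pmf p a)"
    by (intro sum.cong) (auto simp: f'_def)
  also have "\<dots> = measure_pmf.expectation p (\<lambda>x. measure_pmf.expectation (f x) h)"
    using assms by (subst integral_measure_pmf_real[where A = "set_pmf p"]) auto
  finally show ?thesis .
qed

lemma expectation_finite:
  fixes h :: "'a \<Rightarrow> real"
  assumes "finite (set_pmf p)"
  shows "measure_pmf.expectation p h = (\<Sum>x\<in>set_pmf p. pmf p x * h x)"
  using assms by (subst integral_measure_pmf_real[where A = "set_pmf p"]) (auto simp: mult_ac)

lemma expectation_cong:
  fixes h :: "'a \<Rightarrow> real"
  assumes "\<And>x. x \<in> set_pmf p \<Longrightarrow> h x = g x"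
  shows "measure_pmf.expectation p h = measure_pmf.expectation p g"
  by (rule integral_cong_AE) (auto simp: AE_measure_pmf_iff assms)

lemma expectation_mono:
  fixes h :: "'a \<Rightarrow> real"
  assumes "finite (set_pmf p)" "\<And>x. x \<in> set_pmf p \<Longrightarrow> h x \<le> g x"
  shows "measure_pmf.expectation p h \<le> measure_pmf.expectation p g"
  by (rule integral_mono_AE)
     (auto simp: AE_measure_pmf_iff assms intro: integrable_measure_pmf_finite)

lemma expectation_diff:
  fixes h :: "'a \<Rightarrow> real"
  assumes "finite (set_pmf p)"
  shows "measure_pmf.expectation p (\<lambda>x. h x - g x)
           = measure_pmf.expectation p h - measure_pmf.expectation p g"
  by (intro Bochner_Integration.integral_diff integrable_measure_pmf_finite assms)

lemma expectation_add:
  fixes h :: "'a \<Rightarrow> real"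
  assumes "finite (set_pmf p)"
  shows "measure_pmf.expectation p (\<lambda>x. h x + g x)
           = measure_pmf.expectation p h + measure_pmf.expectation p g"
  by (intro Bochner_Integration.integral_add integrable_measure_pmf_finite assms)

lemma expectation_sum:
  fixes h :: "'i \<Rightarrow> 'a \<Rightarrow> real"
  assumes "finite (set_pmf p)"
  shows "measure_pmf.expectation p (\<lambda>x. \<Sum>i\<in>I. h i x)
           = (\<Sum>i\<in>I. measure_pmf.expectation p (h i))"
  by (intro Bochner_Integration.integral_sum integrable_measure_pmf_finite assms)

lemma log_prod_positive:
  fixes f :: "'i \<Rightarrow> real"
  assumes "\<And>i. i \<in> A \<Longrightarrow> f i > 0" "finite A"
  shows "log b (\<Prod>i\<in>A. f i) = (\<Sum>i\<in>A. log b (f i))"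
proof -
  have "f i \<noteq> 0" if "i \<in> A" for i using assms(1)[OF that] by simp
  then show ?thesis using assms(2) by (simp add: log_def ln_prod sum_divide_distrib)
qed

section \<open>Library entropies as expectations of log ratios of probabilities\<close>

lemma countable_pair_count_space:
  "count_space (UNIV :: 'a::countable set) \<Otimes>\<^sub>M count_space (UNIV :: 'b::countable set) = count_space UNIV"
  by (subst pair_measure_countable) auto

text \<open>Probabilities are densities with respect to the counting measure; this is the bridge to
  the library's density formulas for entropy.\<close>

lemma distributed_pmf:
  "distributed (measure_pmf p) (count_space UNIV) X (pmf (map_pmf X p))"
proof -
  have "distr (measure_pmf p) (count_space UNIV) X = measure_pmf (map_pmf X p)"
    by (simp add: map_pmf_rep_eq)
  also have "\<dots> = density (count_space UNIV) (\<lambda>x. ennreal (pmf (map_pmf X p) x))"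
    by (simp add: measure_pmf_eq_density)
  finally show ?thesis by (simp add: distributed_def)
qed

lemma integral_count_space_pmf:
  fixes h :: "'a \<Rightarrow> real"
  shows "(\<integral>x. pmf p x * h x \<partial>count_space UNIV) = measure_pmf.expectation p h"
  by (simp add: measure_pmf_eq_density integral_density)

lemma cond_entropy_pmf_eq:
  fixes X :: "'s \<Rightarrow> 'a::countable" and Y :: "'s \<Rightarrow> 'b::countable"
  assumes "b > 1"
  shows "cond_entropy_pmf b p X Y = - measure_pmf.expectation p
           (\<lambda>s. log b (pmf (map_pmf (\<lambda>s. (X s, Y s)) p) (X s, Y s) / pmf (map_pmf Y p) (Y s)))"
proof -
  interpret information_space "measure_pmf p" b
    by standard (use assms in auto)
  have "cond_entropy_pmf b p X Y = - (\<integral>(x, y). pmf (map_pmf (\<lambda>s. (X s, Y s)) p) (x, y) *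
      log b (pmf (map_pmf (\<lambda>s. (X s, Y s)) p) (x, y) / pmf (map_pmf Y p) y)
      \<partial>(count_space (UNIV :: 'a set) \<Otimes>\<^sub>M count_space (UNIV :: 'b set)))"
    unfolding cond_entropy_pmf_def
    by (rule conditional_entropy_generic_eq)
       (auto intro: sigma_finite_measure_count_space distributed_pmf
         simp: countable_pair_count_space)
  also have "\<dots> = - (\<integral>v. pmf (map_pmf (\<lambda>s. (X s, Y s)) p) v *
      log b (pmf (map_pmf (\<lambda>s. (X s, Y s)) p) v / pmf (map_pmf Y p) (snd v))
      \<partial>count_space UNIV)"
    by (simp add: countable_pair_count_space split_beta')
  finally show ?thesis
    unfolding integral_count_space_pmf by (simp add: expectation_map_pmf)
qed

lemma mutual_info_pmf_eq:
  fixes X :: "'s \<Rightarrow> 'a::countable" and Y :: "'s \<Rightarrow> 'b::countable"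
  assumes "b > 1"
  shows "mutual_info_pmf b p X Y = measure_pmf.expectation p
           (\<lambda>s. log b (pmf (map_pmf (\<lambda>s. (X s, Y s)) p) (X s, Y s)
              / (pmf (map_pmf X p) (X s) * pmf (map_pmf Y p) (Y s))))"
proof -
  interpret information_space "measure_pmf p" b
    by standard (use assms in auto)
  have "mutual_info_pmf b p X Y = (\<integral>v. pmf (map_pmf (\<lambda>s. (X s, Y s)) p) v *
      log b (pmf (map_pmf (\<lambda>s. (X s, Y s)) p) v
        / (pmf (map_pmf X p) (fst v) * pmf (map_pmf Y p) (snd v)))
      \<partial>(count_space (UNIV :: 'a set) \<Otimes>\<^sub>M count_space (UNIV :: 'b set)))"
    unfolding mutual_info_pmf_def
    by (rule mutual_information_distr)
       (auto intro: sigma_finite_measure_count_space distributed_pmf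
         simp: countable_pair_count_space)
  then show ?thesis
    unfolding countable_pair_count_space integral_count_space_pmf by (simp add: expectation_map_pmf)
qed

text \<open>The kernel \<open>k\<close> may be any guess of the law of \<open>X\<close> given \<open>Y\<close>.\<close>

lemma gibbs_conditional:
  fixes X :: "'s \<Rightarrow> 'a" and Y :: "'s \<Rightarrow> 'b" and k :: "'b \<Rightarrow> 'a pmf"
  assumes b: "b > 1" and fin: "finite (set_pmf p)"
    and pos: "\<And>s. s \<in> set_pmf p \<Longrightarrow> pmf (k (Y s)) (X s) > 0"
  shows "measure_pmf.expectation p (\<lambda>s. log b (pmf (k (Y s)) (X s)))
     \<le> measure_pmf.expectation p
         (\<lambda>s. log b (pmf (map_pmf (\<lambda>s. (X s, Y s)) p) (X s, Y s) / pmf (map_pmf Y p) (Y s)))"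
proof -
  define J where "J = map_pmf (\<lambda>s. (X s, Y s)) p"
  define pY where "pY = pmf (map_pmf Y p)"
  define f where "f = (\<lambda>(x, y). pmf (k y) x * pY y / pmf J (x, y))"
  have finJ: "finite (set_pmf J)" using fin by (simp add: J_def)
  have pYp: "pY (Y s) > 0" and Jp: "pmf J (X s, Y s) > 0" if "s \<in> set_pmf p" for s
    using that by (auto simp: pY_def J_def intro!: pmf_positive)
  have "measure_pmf.expectation p (\<lambda>s. log b (pmf (k (Y s)) (X s)))
      - measure_pmf.expectation p (\<lambda>s. log b (pmf J (X s, Y s) / pY (Y s)))
      = measure_pmf.expectation p (\<lambda>s. log b (f (X s, Y s)))"
    unfolding expectation_diff[OF fin, symmetric]
  proof (intro expectation_cong)
    fix s assume "s \<in> set_pmf p"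
    from pos[OF this] pYp[OF this] Jp[OF this] b
    show "log b (pmf (k (Y s)) (X s)) - log b (pmf J (X s, Y s) / pY (Y s)) = log b (f (X s, Y s))"
      by (simp add: f_def log_divide log_mult)
  qed
  also have "\<dots> \<le> measure_pmf.expectation p (\<lambda>s. (f (X s, Y s) - 1) / ln b)"
  proof (intro expectation_mono fin)
    fix s assume "s \<in> set_pmf p"
    from pos[OF this] pYp[OF this] Jp[OF this] have "f (X s, Y s) > 0"
      by (simp add: f_def)
    then show "log b (f (X s, Y s)) \<le> (f (X s, Y s) - 1) / ln b"
      using b by (auto simp: log_def intro!: divide_right_mono ln_le_minus_one)
  qed
  also have "\<dots> = (measure_pmf.expectation J f - 1) / ln b"
    by (simp add: J_def expectation_map_pmf expectation_diff[OF fin])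
  also have "measure_pmf.expectation J f = (\<Sum>v\<in>set_pmf J. pmf (k (snd v)) (fst v) * pY (snd v))"
    unfolding expectation_finite[OF finJ]
    by (intro sum.cong) (auto simp: f_def set_pmf_iff split_beta)
  \<comment> \<open>Enlarging the support to the product of its projections separates the sums; for
    each \<open>y\<close> the kernel then contributes mass at most 1, which bounds the mean
    likelihood ratio by 1.\<close>
  also have "\<dots> \<le> (\<Sum>v\<in>(fst ` set_pmf J) \<times> (snd ` set_pmf J). pmf (k (snd v)) (fst v) * pY (snd v))"
    by (rule sum_mono2) (use finJ in \<open>auto simp: pY_def image_iff intro: prod.collapse[symmetric]\<close>, force+)
  also have "\<dots> = (\<Sum>y\<in>snd ` set_pmf J. pY y * (\<Sum>x\<in>fst ` set_pmf J. pmf (k y) x))"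
    unfolding sum_distrib_left
    by (subst sum.swap) (simp add: sum.cartesian_product split_beta' mult.commute)
  also have "\<dots> \<le> (\<Sum>y\<in>snd ` set_pmf J. pY y * 1)"
    using finJ by (intro sum_mono mult_left_mono)
      (auto simp: pY_def measure_measure_pmf_finite[symmetric])
  also have "\<dots> \<le> 1"
    using finJ by (simp add: pY_def measure_measure_pmf_finite[symmetric])
  finally show ?thesis
    using b by (simp add: J_def pY_def divide_right_mono divide_nonpos_pos)
qed

section \<open>Codes and their marginals\<close>

definition joint_pmf :: "'a pmf \<Rightarrow> ('a \<Rightarrow> 'b pmf) \<Rightarrow> ('a \<times> 'b) pmf" where
  "joint_pmf p k = bind_pmf p (\<lambda>x. map_pmf (Pair x) (k x))"

lemma pmf_joint_pmf: "pmf (joint_pmf p k) (x, y) = pmf p x * pmf (k x) y"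
proof -
  have *: "pmf (map_pmf (Pair a) (k a)) (x, y) = indicator {x} a * pmf (k x) y" for a
  proof (cases "a = x")
    case True
    then show ?thesis by (simp add: pmf_map_inj' inj_on_def)
  next
    case False
    then have "Pair a -` {(x, y)} = {}" by auto
    with False show ?thesis by (simp add: pmf_map)
  qed
  have "pmf (joint_pmf p k) (x, y) = measure_pmf.expectation p (\<lambda>a. indicator {x} a * pmf (k x) y)"
    by (simp add: joint_pmf_def pmf_bind *)
  then show ?thesis by (simp add: pmf.rep_eq)
qed

lemma map_fst_joint_pmf: "map_pmf fst (joint_pmf p k) = p"
  by (simp add: joint_pmf_def map_bind_pmf pmf.map_comp o_def bind_return_pmf')

text \<open>Conditional laws given the first component. The support claim holds for all
  \<open>x\<close>, including those of probability zero, because the alphabet of the auxiliary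
  variable has to contain the support of every kernel value.\<close>

lemma disintegration:
  obtains k where "q = joint_pmf (map_pmf fst q) k"
    and "\<And>x. set_pmf (k x) \<subseteq> snd ` set_pmf q"
proof -
  obtain q0 where q0: "q0 \<in> set_pmf q" using set_pmf_not_empty[of q] by blast
  \<comment> \<open>Off the support of the marginal the kernel is a point mass at a second component
    that does occur.\<close>
  define k where "k = (\<lambda>x. if x \<in> fst ` set_pmf q
     then map_pmf snd (cond_pmf q {v. fst v = x}) else return_pmf (snd q0))"
  have ne: "set_pmf q \<inter> {v. fst v = x} \<noteq> {}" if "x \<in> fst ` set_pmf q" for x
    using that by auto
  have "pmf q v = pmf (joint_pmf (map_pmf fst q) k) v" for v
  proof (cases v)
    case (Pair x y)
    show ?thesis
    proof (cases "x \<in> fst ` set_pmf q")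
      case True
      have "pmf (map_pmf snd (cond_pmf q {v. fst v = x})) y
          = measure (cond_pmf q {v. fst v = x}) {(x, y)}"
        unfolding pmf_map
        by (rule measure_pmf.finite_measure_eq_AE)
           (auto simp: AE_measure_pmf_iff set_cond_pmf[OF ne[OF True]])
      also have "\<dots> = pmf q (x, y) / measure q {v. fst v = x}"
        using ne[OF True] by (simp add: measure_pmf_single pmf_cond)
      also have "measure q {v. fst v = x} = pmf (map_pmf fst q) x"
        by (simp add: pmf_map vimage_def)
      finally show ?thesis
        using True by (simp add: Pair pmf_joint_pmf k_def set_pmf_iff[symmetric])
    next
      case False
      then have "pmf (map_pmf fst q) x = 0" "pmf q (x, y) = 0"
        by (force simp: pmf_eq_0_set_pmf)+
      then show ?thesis by (simp add: Pair pmf_joint_pmf)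
    qed
  qed
  then have "q = joint_pmf (map_pmf fst q) k" by (rule pmf_eqI)
  moreover have "set_pmf (k x) \<subseteq> snd ` set_pmf q" for x
    using q0 ne[of x] by (auto simp: k_def set_cond_pmf)
  ultimately show ?thesis using that by blast
qed

lemma ex_disintegration: "\<exists>k. q = joint_pmf (map_pmf fst q) k"
  by (rule disintegration[of q]) (rule exI)

text \<open>The law is an injective rearrangement of nested \<open>joint_pmf\<close>s, whose
  probabilities multiply. The same device serves for the other joint laws.\<close>

lemma pmf_single_letter_joint:
  "pmf (single_letter_joint P PU PR) (x, y, z, u, r)
     = pmf P (x, y, z) * pmf (PU x) u * pmf (PR u y) r"
proof -
  let ?g = "\<lambda>((x, y, z), u, r). (x, y, z, u, r)"
  have "single_letter_joint P PU PR
      = map_pmf ?g (joint_pmf P (\<lambda>(x, y, z). joint_pmf (PU x) (\<lambda>u. PR u y)))"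
    by (simp add: single_letter_joint_def joint_pmf_def map_bind_pmf bind_map_pmf map_pmf_def
          bind_assoc_pmf bind_return_pmf case_prod_unfold)
  moreover have "inj ?g" by (auto simp: inj_def)
  ultimately show ?thesis
    using pmf_map_inj'[of ?g "joint_pmf P (\<lambda>(x, y, z). joint_pmf (PU x) (\<lambda>u. PR u y))" "((x, y, z), u, r)"]
    by (simp add: pmf_joint_pmf mult.assoc)
qed

lemma set_single_letter_joint:
  "set_pmf (single_letter_joint P PU PR)
     = {(x, y, z, u, r). (x, y, z) \<in> set_pmf P \<and> u \<in> set_pmf (PU x) \<and> r \<in> set_pmf (PR u y)}"
  by (auto simp: single_letter_joint_def split_beta)

lemma finite_single_letter_joint:
  fixes P :: "('x::finite \<times> 'y::finite \<times> 'z::finite) pmf" and PR :: "nat \<Rightarrow> 'y \<Rightarrow> 'r::finite pmf"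
  assumes "\<And>x. finite (set_pmf (PU x))"
  shows "finite (set_pmf (single_letter_joint P PU PR))"
proof (rule finite_subset)
  show "set_pmf (single_letter_joint P PU PR)
      \<subseteq> UNIV \<times> UNIV \<times> UNIV \<times> (\<Union>x. set_pmf (PU x)) \<times> UNIV"
    by (auto simp: set_single_letter_joint)
qed (use assms in auto)

section \<open>Product distributions on lists\<close>

lemma pmf_product_list_pmf:
  assumes "length xs = n"
  shows "pmf (product_list_pmf n q) xs = (\<Prod>i<n. pmf (q i) (xs ! i))"
proof -
  have "xs = map h [0..<n] \<longleftrightarrow> (\<forall>i<n. h i = xs ! i)" for h
  proof safe
    fix i assume "xs = map h [0..<n]" "i < n"
    then show "h i = map h [0..<n] ! i" by simp
  qed (use assms in \<open>auto intro: nth_equalityI\<close>)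
  then have "(\<lambda>h. map h [0..<n]) -` {xs} = Pi {..<n} (\<lambda>i. {xs ! i})"
    by (auto simp: eq_commute[of _ xs])
  then show ?thesis
    by (simp add: product_list_pmf_def pmf_map measure_Pi_pmf_Pi measure_pmf_single)
qed

lemma length_product_list_pmf: "xs \<in> set_pmf (product_list_pmf n q) \<Longrightarrow> length xs = n"
  by (auto simp: product_list_pmf_def)

lemma finite_set_product_list_pmf:
  fixes q :: "nat \<Rightarrow> 'a::finite pmf"
  shows "finite (set_pmf (product_list_pmf n q))"
  by (rule finite_subset[OF _ finite_lists_length_eq[of UNIV n]])
     (auto dest: length_product_list_pmf)

lemma map_nth_product_list_pmf:
  assumes "i < n"
  shows "map_pmf (\<lambda>xs. xs ! i) (product_list_pmf n q) = q i"
proof -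
  have "map_pmf (\<lambda>xs. xs ! i) (product_list_pmf n q)
      = map_pmf (\<lambda>h. h i) (Pi_pmf {..<n} undefined q)"
    unfolding product_list_pmf_def pmf.map_comp using assms by (intro map_pmf_cong) auto
  also have "\<dots> = q i" using assms by (subst Pi_pmf_component) auto
  finally show ?thesis .
qed

lemma pmf_replicate_pmf:
  "length xs = n \<Longrightarrow> pmf (replicate_pmf n p) xs = (\<Prod>i<n. pmf p (xs ! i))"
proof (induction n arbitrary: xs)
  case 0
  then show ?case by simp
next
  case (Suc n)
  then obtain x ys where xs: "xs = x # ys" and ys: "length ys = n" by (cases xs) auto
  let ?c = "\<lambda>(x, ys). x # ys"
  have "replicate_pmf (Suc n) p = map_pmf ?c (joint_pmf p (\<lambda>_. replicate_pmf n p))"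
    by (simp add: joint_pmf_def map_bind_pmf map_pmf_def bind_assoc_pmf bind_return_pmf)
  moreover have "inj ?c" by (auto simp: inj_def)
  ultimately have "pmf (replicate_pmf (Suc n) p) xs = pmf p x * pmf (replicate_pmf n p) ys"
    using pmf_map_inj'[of ?c "joint_pmf p (\<lambda>_. replicate_pmf n p)" "(x, ys)"]
    by (simp add: xs pmf_joint_pmf del: replicate_pmf.simps)
  then show ?case using Suc.IH[OF ys] by (simp add: xs prod.lessThan_Suc_shift del: replicate_pmf.simps prod.lessThan_Suc)
qed

lemma replicate_pmf_map: "replicate_pmf n (map_pmf f p) = map_pmf (map f) (replicate_pmf n p)"
  by (induction n) (simp_all add: map_bind_pmf bind_map_pmf)

text \<open>By independence the letter at position \<open>i\<close> may be drawn first and inserted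
  afterwards; this isolates one position of a block code.\<close>

lemma replicate_pmf_split_nth:
  assumes "i < n"
  shows "replicate_pmf n p
    = do {x \<leftarrow> p; ys \<leftarrow> replicate_pmf (n - 1) p; return_pmf (take i ys @ x # drop i ys)}"
proof -
  obtain m where n: "n = i + Suc m" using assms less_iff_Suc_add by auto
  have "replicate_pmf n p = do {us \<leftarrow> replicate_pmf i p; x \<leftarrow> p; vs \<leftarrow> replicate_pmf m p;
          return_pmf (us @ x # vs)}"
    unfolding n replicate_pmf_distrib by (simp add: bind_assoc_pmf bind_return_pmf)
  also have "\<dots> = do {x \<leftarrow> p; us \<leftarrow> replicate_pmf i p; vs \<leftarrow> replicate_pmf m p;
          return_pmf (us @ x # vs)}"
    by (rule bind_commute_pmf)
  also have "\<dots> = do {x \<leftarrow> p; us \<leftarrow> replicate_pmf i p; vs \<leftarrow> replicate_pmf m p;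
          return_pmf (take i (us @ vs) @ x # drop i (us @ vs))}"
    by (intro bind_pmf_cong refl) (auto simp: set_replicate_pmf)
  also have "\<dots> = do {x \<leftarrow> p; ys \<leftarrow> replicate_pmf (n - 1) p; return_pmf (take i ys @ x # drop i ys)}"
    by (simp add: n replicate_pmf_distrib bind_assoc_pmf bind_return_pmf)
  finally show ?thesis .
qed

lemma finite_set_replicate_pmf:
  assumes "finite (set_pmf p)"
  shows "finite (set_pmf (replicate_pmf n p))"
  by (rule finite_subset[OF _ finite_lists_length_eq[OF assms, of n]])
     (auto simp: set_replicate_pmf)

section \<open>The joint law of a code and its marginals at one position\<close>

lemma set_code_joint:
  assumes "v \<in> set_pmf (code_joint P n c)"
  obtains xs ys zs rs where "v = (xs, ys, zs, enc c xs, rs)" "length xs = n" "length ys = n"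
    "length zs = n" "length rs = n"
  using assms by (auto simp: code_joint_def Let_def set_replicate_pmf dest!: length_product_list_pmf)

lemma finite_code_joint:
  fixes P :: "('x::finite \<times> 'y::finite \<times> 'z::finite) pmf" and c :: "('x, 'y, 'r::finite) code"
  shows "finite (set_pmf (code_joint P n c))"
  by (auto simp: code_joint_def Let_def intro!: finite_set_replicate_pmf finite_set_product_list_pmf)

lemma pmf_code_joint:
  fixes P :: "('x \<times> 'y \<times> 'z) pmf"
  assumes "length xs = n" "length ys = n" "length zs = n" "length rs = n"
  shows "pmf (code_joint P n c) (xs, ys, zs, enc c xs, rs)
    = (\<Prod>i<n. pmf P (xs ! i, ys ! i, zs ! i) * pmf (dec c i (enc c xs) (ys ! i)) (rs ! i))"
proof -
  let ?x = "map (\<lambda>(x, y, z). x)" and ?y = "map (\<lambda>(x, y, z). y)" and ?z = "map (\<lambda>(x, y, z). z)"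
  let ?g = "\<lambda>(s :: ('x \<times> 'y \<times> 'z) list, rs). (?x s, ?y s, ?z s, enc c (?x s), rs)"
  let ?k = "\<lambda>s. product_list_pmf n (\<lambda>i. dec c i (enc c (?x s)) (?y s ! i))"
  define s where "s = zip xs (zip ys zs)"
  have s: "length s = n" "?x s = xs" "?y s = ys" "?z s = zs"
    using assms by (auto simp: s_def intro!: nth_equalityI)
  have eq: "code_joint P n c = map_pmf ?g (joint_pmf (replicate_pmf n P) ?k)"
    by (simp add: code_joint_def joint_pmf_def Let_def map_bind_pmf map_pmf_def bind_assoc_pmf
        bind_return_pmf)
  have "zip (?x t) (zip (?y t) (?z t)) = t" for t :: "('x \<times> 'y \<times> 'z) list"
    by (intro nth_equalityI) (auto simp: split_beta)
  \<comment> \<open>The message is recomputed from the source block, so the left inverse can drop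
    it.\<close>
  then have "inj ?g"
    by (intro inj_on_inverseI[where g = "\<lambda>(xs, ys, zs, w, rs). (zip xs (zip ys zs), rs)"]) auto
  then have "pmf (code_joint P n c) (?g (s, rs)) = pmf (replicate_pmf n P) s * pmf (?k s) rs"
    unfolding eq by (subst pmf_map_inj') (simp_all add: pmf_joint_pmf)
  then show ?thesis
    using assms s by (simp add: pmf_replicate_pmf pmf_product_list_pmf prod.distrib s_def)
qed

text \<open>The conditional law of the message given that the source letter at position
  \<open>i\<close> is \<open>x\<close>: the test channel from X to U for the choice U = W.\<close>

definition message_kernel :: "'x pmf \<Rightarrow> nat \<Rightarrow> ('x list \<Rightarrow> nat) \<Rightarrow> nat \<Rightarrow> 'x \<Rightarrow> nat pmf" where
  "message_kernel p n f i x = map_pmf (\<lambda>xs. f (take i xs @ x # drop i xs)) (replicate_pmf (n - 1) p)"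

text \<open>This is where memoryless reconstruction enters: the symbol at position \<open>i\<close>
  is drawn from the message and the side information at \<open>i\<close> alone, so the marginal has
  exactly the single-letter form with the message as auxiliary variable.\<close>

lemma code_joint_marginal:
  assumes "i < n"
  shows "map_pmf (\<lambda>(xs, ys, zs, w, rs). (xs ! i, ys ! i, zs ! i, w, rs ! i)) (code_joint P n c)
    = single_letter_joint P (message_kernel (map_pmf fst P) n (enc c) i) (dec c i)"
proof -
  let ?x = "\<lambda>(x, y, z). x" and ?y = "\<lambda>(x, y, z). y" and ?z = "\<lambda>(x, y, z). z"
  have fst: "?x = fst" by auto
  have "map_pmf (\<lambda>(xs, ys, zs, w, rs). (xs ! i, ys ! i, zs ! i, w, rs ! i)) (code_joint P n c)
    = do {s \<leftarrow> replicate_pmf n P;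
          rs \<leftarrow> product_list_pmf n (\<lambda>j. dec c j (enc c (map ?x s)) (map ?y s ! j));
          return_pmf (map ?x s ! i, map ?y s ! i, map ?z s ! i, enc c (map ?x s), rs ! i)}"
    by (simp add: code_joint_def Let_def map_bind_pmf)
  also have "\<dots> = do {s \<leftarrow> replicate_pmf n P;
          r \<leftarrow> map_pmf (\<lambda>rs. rs ! i)
            (product_list_pmf n (\<lambda>j. dec c j (enc c (map ?x s)) (map ?y s ! j)));
          return_pmf (map ?x s ! i, map ?y s ! i, map ?z s ! i, enc c (map ?x s), r)}"
    by (simp add: bind_map_pmf)
  also have "\<dots> = do {s \<leftarrow> replicate_pmf n P;
          r \<leftarrow> dec c i (enc c (map ?x s)) (map ?y s ! i);
          return_pmf (map ?x s ! i, map ?y s ! i, map ?z s ! i, enc c (map ?x s), r)}"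
    by (simp only: map_nth_product_list_pmf[OF assms])
  \<comment> \<open>Once letter \<open>i\<close> is drawn first, the remaining letters influence the
    output at \<open>i\<close> only through the message.\<close>
  also have "\<dots> = do {t \<leftarrow> P; ss \<leftarrow> replicate_pmf (n - 1) P;
          r \<leftarrow> dec c i (enc c (take i (map fst ss) @ ?x t # drop i (map fst ss))) (?y t);
          return_pmf (?x t, ?y t, ?z t, enc c (take i (map fst ss) @ ?x t # drop i (map fst ss)), r)}"
    unfolding replicate_pmf_split_nth[OF assms, of P] bind_assoc_pmf bind_return_pmf
    using assms
    by (intro bind_pmf_cong refl)
       (auto simp: set_replicate_pmf nth_append take_map drop_map split_beta fst)
  also have "\<dots> = single_letter_joint P (message_kernel (map_pmf fst P) n (enc c) i) (dec c i)"
    by (simp add: single_letter_joint_def message_kernel_def replicate_pmf_map bind_map_pmf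
        pmf.map_comp o_def case_prod_unfold)
  finally show ?thesis .
qed

lemma replicate_marginal:
  assumes "i < n"
  shows "map_pmf (\<lambda>xs. (xs ! i, f xs)) (replicate_pmf n p) = joint_pmf p (message_kernel p n f i)"
proof -
  have "map_pmf (\<lambda>xs. (xs ! i, f xs)) (replicate_pmf n p)
     = do {x \<leftarrow> p; ys \<leftarrow> replicate_pmf (n - 1) p;
         return_pmf ((take i ys @ x # drop i ys) ! i, f (take i ys @ x # drop i ys))}"
    by (simp add: replicate_pmf_split_nth[OF assms] map_bind_pmf)
  also have "\<dots> = do {x \<leftarrow> p; ys \<leftarrow> replicate_pmf (n - 1) p;
         return_pmf (x, f (take i ys @ x # drop i ys))}"
    using assms by (intro bind_pmf_cong refl) (auto simp: set_replicate_pmf nth_append)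
  also have "\<dots> = joint_pmf p (message_kernel p n f i)"
    by (simp add: joint_pmf_def message_kernel_def pmf.map_comp o_def)
      (simp add: map_pmf_def)
  finally show ?thesis .
qed

section \<open>Entropies of mixtures\<close>

definition ent_term :: "real \<Rightarrow> real \<Rightarrow> real" where
  "ent_term b t = - t * log b t"

definition ent :: "real \<Rightarrow> 'a::finite pmf \<Rightarrow> real" where
  "ent b p = (\<Sum>a\<in>UNIV. ent_term b (pmf p a))"

lemma sum_UNIV_prod:
  fixes f :: "'a::finite \<times> 'b::finite \<Rightarrow> real"
  shows "sum f UNIV = (\<Sum>y\<in>UNIV. \<Sum>z\<in>UNIV. f (y, z))"
  by (simp add: sum.cartesian_product)

lemma expectation_UNIV:
  fixes h :: "'a::finite \<Rightarrow> real"
  shows "measure_pmf.expectation p h = (\<Sum>x\<in>UNIV. pmf p x * h x)"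
  by (subst integral_measure_pmf_real[where A = UNIV]) (auto simp: mult.commute)

lemma ent_eq_expectation: "ent b p = - measure_pmf.expectation p (\<lambda>x. log b (pmf p x))"
  by (simp add: ent_def ent_term_def expectation_UNIV sum_negf)

lemma expectation_joint_pmf:
  fixes h :: "'a \<times> 'b \<Rightarrow> real"
  assumes "finite (set_pmf p)" "\<And>x. finite (set_pmf (k x))"
  shows "measure_pmf.expectation (joint_pmf p k) h
    = measure_pmf.expectation p (\<lambda>x. measure_pmf.expectation (k x) (\<lambda>y. h (x, y)))"
  unfolding joint_pmf_def
  by (subst expectation_bind_finite) (use assms in \<open>auto simp: expectation_map_pmf\<close>)

lemma cond_entropy_pmf_inj:
  fixes X :: "'s \<Rightarrow> 'a::countable" and Y :: "'s \<Rightarrow> 'b::countable" and g :: "'b \<Rightarrow> 'c::countable"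
  assumes "b > 1" "inj g"
  shows "cond_entropy_pmf b p X (\<lambda>s. g (Y s)) = cond_entropy_pmf b p X Y"
proof -
  have 1: "pmf (map_pmf (\<lambda>s. g (Y s)) p) (g y) = pmf (map_pmf Y p) y" for y
    using pmf_map_inj'[OF assms(2), of "map_pmf Y p" y] by (simp add: pmf.map_comp o_def)
  have "inj (apsnd g :: 'a \<times> 'b \<Rightarrow> _)" using assms(2) by (auto simp: inj_def)
  from pmf_map_inj'[OF this, of "map_pmf (\<lambda>s. (X s, Y s)) p"]
  have 2: "pmf (map_pmf (\<lambda>s. (X s, g (Y s))) p) (x, g y) = pmf (map_pmf (\<lambda>s. (X s, Y s)) p) (x, y)"
    for x y by (simp add: pmf.map_comp o_def) (metis apsnd_conv)
  show ?thesis by (simp add: cond_entropy_pmf_eq[OF assms(1)] 1 2)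
qed

text \<open>Given \<open>U = u\<close> the pair has law \<open>T u\<close>, and H(A|B) = H(A,B) -
  H(B) for that law; the weight of \<open>u\<close> cancels inside the logarithm. This is what makes
  conditional entropies given U linear in the weights of the mixture.\<close>

lemma cond_entropy_mixture:
  fixes A :: "'s \<Rightarrow> 'a::finite" and B :: "'s \<Rightarrow> 'b::finite" and U :: "'s \<Rightarrow> 'u::countable"
  assumes b: "b > 1" and fin: "finite (set_pmf lam)"
    and J: "map_pmf (\<lambda>s. (U s, A s, B s)) J = joint_pmf lam T"
  shows "cond_entropy_pmf b J A (\<lambda>s. (U s, B s))
    = measure_pmf.expectation lam (\<lambda>u. ent b (T u) - ent b (map_pmf snd (T u)))"
proof -
  have UB: "map_pmf (\<lambda>s. (U s, B s)) J = joint_pmf lam (\<lambda>u. map_pmf snd (T u))"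
    using arg_cong[OF J, of "map_pmf (\<lambda>(u, a, b). (u, b))"]
    by (simp add: pmf.map_comp o_def joint_pmf_def map_bind_pmf case_prod_unfold)
  have "map_pmf (\<lambda>s. (A s, U s, B s)) J = map_pmf (\<lambda>(u, a, b). (a, u, b)) (joint_pmf lam T)"
    unfolding J[symmetric] by (simp add: pmf.map_comp o_def)
  moreover have "inj (\<lambda>(u :: 'u, a :: 'a, b :: 'b). (a, u, b))" by (auto simp: inj_def)
  ultimately have AUB: "pmf (map_pmf (\<lambda>s. (A s, U s, B s)) J) (a, u, b') = pmf lam u * pmf (T u) (a, b')"
    for a u b'
    using pmf_map_inj'[of "\<lambda>(u :: 'u, a :: 'a, b :: 'b). (a, u, b)" "joint_pmf lam T" "(u, a, b')"]
    by (simp add: pmf_joint_pmf)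
  have "cond_entropy_pmf b J A (\<lambda>s. (U s, B s))
    = - measure_pmf.expectation J (\<lambda>s. (\<lambda>(u, a, b').
         log b (pmf lam u * pmf (T u) (a, b') / (pmf lam u * pmf (map_pmf snd (T u)) b')))
         (U s, A s, B s))"
    by (simp add: cond_entropy_pmf_eq[OF b] UB AUB pmf_joint_pmf)
  also have "\<dots> = - measure_pmf.expectation (joint_pmf lam T) (\<lambda>(u, a, b').
         log b (pmf lam u * pmf (T u) (a, b') / (pmf lam u * pmf (map_pmf snd (T u)) b')))"
    unfolding J[symmetric] expectation_map_pmf ..
  also have "\<dots> = - measure_pmf.expectation lam (\<lambda>u. measure_pmf.expectation (T u) (\<lambda>(a, b').
         log b (pmf lam u * pmf (T u) (a, b') / (pmf lam u * pmf (map_pmf snd (T u)) b'))))"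
    by (subst expectation_joint_pmf) (simp_all add: fin case_prod_unfold cong: if_cong)
  also have "\<dots> = - measure_pmf.expectation lam (\<lambda>u. measure_pmf.expectation (T u) (\<lambda>v.
         log b (pmf (T u) v)) - measure_pmf.expectation (map_pmf snd (T u)) (\<lambda>v.
         log b (pmf (map_pmf snd (T u)) v)))"
  proof (intro arg_cong[where f = uminus] expectation_cong)
    fix u assume "u \<in> set_pmf lam"
    then have u: "pmf lam u > 0" by (rule pmf_positive)
    show "measure_pmf.expectation (T u) (\<lambda>(a, b').
        log b (pmf lam u * pmf (T u) (a, b') / (pmf lam u * pmf (map_pmf snd (T u)) b')))
      = measure_pmf.expectation (T u) (\<lambda>v. log b (pmf (T u) v))
        - measure_pmf.expectation (map_pmf snd (T u)) (\<lambda>v. log b (pmf (map_pmf snd (T u)) v))"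
      unfolding expectation_map_pmf
    proof (subst expectation_diff[symmetric], simp, intro expectation_cong)
      fix v assume v: "v \<in> set_pmf (T u)"
      then have "pmf (map_pmf snd (T u)) (snd v) > 0" by (intro pmf_positive) simp
      with u pmf_positive[OF v] b
      show "(case v of (a, b') \<Rightarrow> log b (pmf lam u * pmf (T u) (a, b')
            / (pmf lam u * pmf (map_pmf snd (T u)) b')))
        = log b (pmf (T u) v) - log b (pmf (map_pmf snd (T u)) (snd v))"
        by (simp add: case_prod_unfold log_divide)
    qed
  qed
  finally show ?thesis
    unfolding ent_eq_expectation using fin
    by (simp add: expectation_diff integrable_measure_pmf_finite)
qed

lemma mutual_info_pmf_eq_diff:
  fixes X :: "'s \<Rightarrow> 'a::countable" and Y :: "'s \<Rightarrow> 'b::countable"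
  assumes b: "b > 1" and fin: "finite (set_pmf p)"
  shows "mutual_info_pmf b p X Y
    = - cond_entropy_pmf b p X Y - measure_pmf.expectation p (\<lambda>s. log b (pmf (map_pmf X p) (X s)))"
proof -
  have "mutual_info_pmf b p X Y = measure_pmf.expectation p
      (\<lambda>s. log b (pmf (map_pmf (\<lambda>s. (X s, Y s)) p) (X s, Y s) / pmf (map_pmf Y p) (Y s))
         - log b (pmf (map_pmf X p) (X s)))"
    unfolding mutual_info_pmf_eq[OF b]
  proof (intro expectation_cong)
    fix s assume "s \<in> set_pmf p"
    then have "pmf (map_pmf (\<lambda>s. (X s, Y s)) p) (X s, Y s) > 0" "pmf (map_pmf Y p) (Y s) > 0"
      "pmf (map_pmf X p) (X s) > 0"
      by (auto intro!: pmf_positive)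
    with b show "log b (pmf (map_pmf (\<lambda>s. (X s, Y s)) p) (X s, Y s)
          / (pmf (map_pmf X p) (X s) * pmf (map_pmf Y p) (Y s)))
        = log b (pmf (map_pmf (\<lambda>s. (X s, Y s)) p) (X s, Y s) / pmf (map_pmf Y p) (Y s))
         - log b (pmf (map_pmf X p) (X s))"
      by (simp add: log_divide log_mult)
  qed
  then show ?thesis by (simp add: cond_entropy_pmf_eq[OF b] expectation_diff[OF fin])
qed

lemma mutual_info_pmf_eq_ent:
  fixes X :: "'s \<Rightarrow> 'a::finite" and Y :: "'s \<Rightarrow> 'b::countable"
  assumes b: "b > 1" and fin: "finite (set_pmf p)"
  shows "mutual_info_pmf b p X Y = ent b (map_pmf X p) - cond_entropy_pmf b p X Y"
  by (simp add: mutual_info_pmf_eq_diff[OF b fin] ent_eq_expectation expectation_map_pmf)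

text \<open>Gibbs' inequality with a guess that ignores \<open>Y\<close>, namely the marginal law of
  \<open>X\<close>.\<close>

lemma mutual_info_pmf_nonneg:
  fixes X :: "'s \<Rightarrow> 'a::countable" and Y :: "'s \<Rightarrow> 'b::countable"
  assumes b: "b > 1" and fin: "finite (set_pmf p)"
  shows "mutual_info_pmf b p X Y \<ge> 0"
proof -
  have "measure_pmf.expectation p (\<lambda>s. log b (pmf (map_pmf X p) (X s))) \<le> - cond_entropy_pmf b p X Y"
    unfolding cond_entropy_pmf_eq[OF b] minus_minus
    by (rule gibbs_conditional[OF b fin, of "\<lambda>_. map_pmf X p"]) (auto intro!: pmf_positive)
  then show ?thesis by (simp add: mutual_info_pmf_eq_diff[OF b fin])
qed

text \<open>The single-letter law generated in the reverse order: \<open>U\<close> first, then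
  \<open>X\<close> through the backward channel \<open>Q\<close>. In this order the weights of
  \<open>U\<close> are free parameters.\<close>

definition mixture_joint ::
  "('x \<Rightarrow> ('y \<times> 'z) pmf) \<Rightarrow> nat pmf \<Rightarrow> (nat \<Rightarrow> 'x pmf) \<Rightarrow> (nat \<Rightarrow> 'y \<Rightarrow> 'r pmf)
    \<Rightarrow> ('x \<times> 'y \<times> 'z \<times> nat \<times> 'r) pmf"
  where
  "mixture_joint C lam Q k =
     do {u \<leftarrow> lam; x \<leftarrow> Q u; (y, z) \<leftarrow> C x; r \<leftarrow> k u y; return_pmf (x, y, z, u, r)}"

lemma pmf_mixture_joint:
  "pmf (mixture_joint C lam Q k) (x, y, z, u, r)
     = pmf lam u * pmf (Q u) x * pmf (C x) (y, z) * pmf (k u y) r"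
proof -
  let ?g = "\<lambda>(u, x, (y, z), r). (x, y, z, u, r)"
  let ?j = "joint_pmf lam (\<lambda>u. joint_pmf (Q u) (\<lambda>x. joint_pmf (C x) (\<lambda>(y, z). k u y)))"
  have "mixture_joint C lam Q k = map_pmf ?g ?j"
    by (simp add: mixture_joint_def joint_pmf_def map_bind_pmf bind_map_pmf map_pmf_def
          bind_assoc_pmf bind_return_pmf case_prod_unfold)
  moreover have "inj ?g" by (auto simp: inj_def)
  ultimately show ?thesis
    using pmf_map_inj'[of ?g ?j "(u, x, (y, z), r)"]
    by (simp add: pmf_joint_pmf mult.assoc)
qed

text \<open>The law of the reconstruction and the eavesdropper's letter, conditional on one value of
  the auxiliary variable.\<close>

definition letter_law ::
  "('x \<Rightarrow> ('y \<times> 'z) pmf) \<Rightarrow> 'x pmf \<Rightarrow> ('y \<Rightarrow> 'r pmf) \<Rightarrow> ('r \<times> 'z) pmf" where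
  "letter_law C q k = do {x \<leftarrow> q; (y, z) \<leftarrow> C x; r \<leftarrow> k y; return_pmf (r, z)}"

lemma pmf_letter_law:
  fixes C :: "'x::finite \<Rightarrow> ('y::finite \<times> 'z::finite) pmf" and k :: "'y \<Rightarrow> 'r::finite pmf"
  shows "pmf (letter_law C q k) (r, z) = (\<Sum>x\<in>UNIV. \<Sum>y\<in>UNIV. pmf q x * pmf (C x) (y, z) * pmf (k y) r)"
proof -
  have "pmf (letter_law C q k) (r, z) = (\<Sum>x\<in>UNIV. \<Sum>v\<in>UNIV. \<Sum>r'\<in>UNIV.
      pmf q x * pmf (C x) v * pmf (k (fst v)) r' * pmf (return_pmf (r', snd v)) (r, z))"
    by (simp add: letter_law_def pmf_bind expectation_UNIV case_prod_unfold sum_distrib_left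
        mult.assoc del: pmf_return)
  also have "\<dots> = (\<Sum>x\<in>UNIV. \<Sum>v\<in>UNIV. pmf q x * pmf (C x) v * pmf (k (fst v)) r
      * (if snd v = z then 1 else 0))"
    by (intro sum.cong refl) (auto simp: indicator_def if_distrib of_bool_def cong: if_cong)
  also have "\<dots> = (\<Sum>x\<in>UNIV. \<Sum>y\<in>UNIV. \<Sum>z'\<in>UNIV. pmf q x * pmf (C x) (y, z') * pmf (k y) r
      * (if z' = z then 1 else 0))"
    by (intro sum.cong refl) (simp add: indicator_def of_bool_def sum_UNIV_prod)
  finally show ?thesis by (simp add: if_distrib cong: if_cong)
qed

lemma pmf_map_snd_letter_law:
  fixes C :: "'x::finite \<Rightarrow> ('y::finite \<times> 'z::finite) pmf" and k :: "'y \<Rightarrow> 'r::finite pmf"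
  shows "pmf (map_pmf snd (letter_law C q k)) z = (\<Sum>x\<in>UNIV. \<Sum>y\<in>UNIV. pmf q x * pmf (C x) (y, z))"
proof -
  have "map_pmf snd (letter_law C q k) = do {x \<leftarrow> q; v \<leftarrow> C x; return_pmf (snd v)}"
    by (simp add: letter_law_def map_bind_pmf case_prod_unfold)
  then have "pmf (map_pmf snd (letter_law C q k)) z
      = (\<Sum>x\<in>UNIV. \<Sum>v\<in>UNIV. pmf q x * pmf (C x) v * pmf (return_pmf (snd v)) z)"
    by (simp add: pmf_bind expectation_UNIV sum_distrib_left mult.assoc del: pmf_return)
  also have "\<dots> = (\<Sum>x\<in>UNIV. \<Sum>y\<in>UNIV. \<Sum>z'\<in>UNIV. pmf q x * pmf (C x) (y, z')
      * (if z' = z then 1 else 0))"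
    by (intro sum.cong refl) (simp add: indicator_def of_bool_def sum_UNIV_prod)
  finally show ?thesis by (simp add: if_distrib cong: if_cong)
qed

section \<open>The convex body of single-letter points\<close>

text \<open>Distributions are transported to Euclidean vectors because compactness and
  Caratheodory's theorem are used there.\<close>

definition simplex_vec :: "(real ^ 'a::finite) set" where
  "simplex_vec = {q. (\<forall>x. q $ x \<ge> 0) \<and> (\<Sum>x\<in>UNIV. q $ x) = 1}"

definition vec_of_pmf :: "'a::finite pmf \<Rightarrow> real ^ 'a" where
  "vec_of_pmf p = (\<chi> x. pmf p x)"

definition pmf_of_vec :: "real ^ 'a::finite \<Rightarrow> 'a pmf" where
  "pmf_of_vec q = embed_pmf (\<lambda>x. q $ x)"

lemma vec_of_pmf_in_simplex: "vec_of_pmf p \<in> simplex_vec"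
  by (auto simp: vec_of_pmf_def simplex_vec_def sum_pmf_eq_1)

lemma pmf_pmf_of_vec: "q \<in> simplex_vec \<Longrightarrow> pmf (pmf_of_vec q) x = q $ x"
  unfolding pmf_of_vec_def
  by (rule pmf_embed_pmf) (auto simp: simplex_vec_def nn_integral_count_space_finite sum_ennreal)

lemma vec_of_pmf_of_vec: "q \<in> simplex_vec \<Longrightarrow> vec_of_pmf (pmf_of_vec q) = q"
  by (simp add: vec_of_pmf_def pmf_pmf_of_vec vec_eq_iff)

lemma compact_simplex_vec: "compact (simplex_vec :: (real ^ 'a::finite) set)"
proof -
  have "closed {q :: real ^ 'a. (\<forall>x. q $ x \<ge> 0) \<and> (\<Sum>x\<in>UNIV. q $ x) = 1}"
    by (intro closed_Collect_conj closed_Collect_all closed_Collect_le closed_Collect_eq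
          continuous_intros)
  moreover have "norm q \<le> 1" if "q \<in> simplex_vec" for q :: "real ^ 'a"
    using norm_le_l1_cart[of q] that by (simp add: simplex_vec_def)
  then have "bounded (simplex_vec :: (real ^ 'a) set)" by (auto simp: bounded_iff)
  ultimately show ?thesis by (simp add: compact_eq_bounded_closed simplex_vec_def)
qed

text \<open>Only the origin is in question, where t ln t tends to 0 and the term has value
  0.\<close>

lemma continuous_on_ent_term: "b > 1 \<Longrightarrow> continuous_on {0..} (ent_term b)"
proof -
  assume b: "b > 1"
  have "((\<lambda>t::real. t * ln t) \<longlongrightarrow> 0) (at_right 0)" by real_asymp
  then have *: "((\<lambda>t::real. t * ln t) \<longlongrightarrow> 0) (at 0 within {0..})"
    by (simp add: at_within_Ici_at_right)
  have "continuous_on {0..} (\<lambda>t::real. t * ln t)"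
    unfolding continuous_on_def
  proof
    fix x :: real assume "x \<in> {0..}"
    then consider "x = 0" | "x > 0" by force
    then show "((\<lambda>t. t * ln t) \<longlongrightarrow> x * ln x) (at x within {0..})"
      by cases (use * in \<open>auto intro!: tendsto_intros\<close>)
  qed
  then have "continuous_on {0..} (\<lambda>t. - (t * ln t) / ln b)"
    using b by (intro continuous_on_divide continuous_on_minus continuous_on_const) auto
  then show ?thesis by (simp add: ent_term_def log_def)
qed

type_synonym 'x point = "(real ^ 'x) \<times> real \<times> real \<times> real"

text \<open>\<open>q\<close> stands for the law of X given \<open>U = u\<close> and \<open>k\<close>
  for the decoder at that \<open>u\<close>. The last coordinate is H(R,Z) - H(Z), that is H(R|Z),
  written without division so that continuity is visible.\<close>

definition letter_point ::
  "real \<Rightarrow> ('x::finite \<Rightarrow> ('y::finite \<times> 'z::finite) pmf) \<Rightarrow> ('x \<Rightarrow> 'y \<Rightarrow> 'r::finite \<Rightarrow> real)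
    \<Rightarrow> 'x pmf \<Rightarrow> ('y \<Rightarrow> 'r pmf) \<Rightarrow> 'x point"
  where
  "letter_point b C g q k =
     (vec_of_pmf q, ent b q,
      (\<Sum>x\<in>UNIV. \<Sum>y\<in>UNIV. \<Sum>z\<in>UNIV. \<Sum>r\<in>UNIV. pmf q x * pmf (C x) (y, z) * pmf (k y) r * g x y r),
      ent b (letter_law C q k) - ent b (map_pmf snd (letter_law C q k)))"

definition letter_points ::
  "real \<Rightarrow> ('x::finite \<Rightarrow> ('y::finite \<times> 'z::finite) pmf) \<Rightarrow> ('x \<Rightarrow> 'y \<Rightarrow> 'r::finite \<Rightarrow> real)
    \<Rightarrow> 'x point set"
  where "letter_points b C g = range (\<lambda>(q, k). letter_point b C g q k)"

text \<open>The coordinates, rewritten as a function \<open>G\<close> of probability vectors, are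
  continuous on a product of simplices \<open>D\<close>, which is closed and bounded; the entropy
  terms are continuous there because their arguments are nonnegative.\<close>

lemma compact_letter_points:
  fixes C :: "'x::finite \<Rightarrow> ('y::finite \<times> 'z::finite) pmf" and g :: "'x \<Rightarrow> 'y \<Rightarrow> 'r::finite \<Rightarrow> real"
  assumes b: "b > 1"
  shows "compact (letter_points b C g)"
proof -
  define D :: "((real ^ 'x) \<times> (real ^ 'r ^ 'y)) set" where
    "D = simplex_vec \<times> {\<kappa>. \<forall>y. \<kappa> $ y \<in> simplex_vec}"
  define G :: "(real ^ 'x) \<times> (real ^ 'r ^ 'y) \<Rightarrow> 'x point" where
    "G = (\<lambda>(q, \<kappa>). (q, \<Sum>x\<in>UNIV. ent_term b (q $ x),
      \<Sum>x\<in>UNIV. \<Sum>y\<in>UNIV. \<Sum>z\<in>UNIV. \<Sum>r\<in>UNIV. q $ x * pmf (C x) (y, z) * \<kappa> $ y $ r * g x y r,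
      (\<Sum>(r, z)\<in>UNIV. ent_term b (\<Sum>x\<in>UNIV. \<Sum>y\<in>UNIV. q $ x * pmf (C x) (y, z) * \<kappa> $ y $ r))
       - (\<Sum>z\<in>UNIV. ent_term b (\<Sum>x\<in>UNIV. \<Sum>y\<in>UNIV. q $ x * pmf (C x) (y, z)))))"
  have G: "G (vec_of_pmf q, \<chi> y. vec_of_pmf (k y)) = letter_point b C g q k" for q k
  proof -
    have "pmf (letter_law C q k) v
        = (\<Sum>x\<in>UNIV. \<Sum>y\<in>UNIV. pmf q x * pmf (C x) (y, snd v) * pmf (k y) (fst v))" for v
      by (cases v) (simp add: pmf_letter_law)
    then show ?thesis
      by (simp add: G_def letter_point_def ent_def vec_of_pmf_def pmf_map_snd_letter_law
          case_prod_unfold)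
  qed
  have "letter_points b C g = G ` D"
  proof (intro subset_antisym subsetI)
    fix v assume "v \<in> letter_points b C g"
    then obtain q k where "v = letter_point b C g q k" by (auto simp: letter_points_def)
    then have "v = G (vec_of_pmf q, \<chi> y. vec_of_pmf (k y))" by (simp add: G)
    then show "v \<in> G ` D"
      by (rule image_eqI) (simp add: D_def vec_of_pmf_in_simplex)
  next
    fix v assume "v \<in> G ` D"
    then obtain q \<kappa> where v: "v = G (q, \<kappa>)" and "(q, \<kappa>) \<in> D" by auto
    then have *: "vec_of_pmf (pmf_of_vec q) = q" "(\<chi> y. vec_of_pmf (pmf_of_vec (\<kappa> $ y))) = \<kappa>"
      by (simp_all add: D_def vec_of_pmf_of_vec vec_eq_iff)
    have "G (q, \<kappa>) = letter_point b C g (pmf_of_vec q) (\<lambda>y. pmf_of_vec (\<kappa> $ y))"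
      using G[of "pmf_of_vec q" "\<lambda>y. pmf_of_vec (\<kappa> $ y)"] by (simp add: *)
    then show "v \<in> letter_points b C g"
      by (auto simp: v letter_points_def)
  qed
  moreover have "compact D"
  proof -
    have "closed {\<kappa> :: real ^ 'r ^ 'y. \<forall>y. \<kappa> $ y \<in> simplex_vec}"
      by (intro closed_Collect_all closed_vimage[unfolded vimage_def] compact_imp_closed
            compact_simplex_vec continuous_intros)
    moreover have "norm \<kappa> \<le> real CARD('y)"
      if "\<forall>y. \<kappa> $ y \<in> simplex_vec" for \<kappa> :: "real ^ 'r ^ 'y"
    proof -
      have "norm (\<kappa> $ y) \<le> 1" for y
        using norm_le_l1_cart[of "\<kappa> $ y"] that by (simp add: simplex_vec_def)
      then have "(\<Sum>y\<in>UNIV. norm (\<kappa> $ y)) \<le> (\<Sum>y\<in>(UNIV :: 'y set). 1)" by (intro sum_mono)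
      then show ?thesis
        using norm_vec_def[of \<kappa>] L2_set_le_sum[of UNIV "\<lambda>y. norm (\<kappa> $ y)"] by simp
    qed
    then have "bounded {\<kappa> :: real ^ 'r ^ 'y. \<forall>y. \<kappa> $ y \<in> simplex_vec}" by (auto simp: bounded_iff)
    ultimately show ?thesis
      unfolding D_def
      by (intro compact_Times compact_simplex_vec) (simp add: compact_eq_bounded_closed)
  qed
  moreover have "continuous_on D G"
  proof -
    have ent: "continuous_on D (\<lambda>v. ent_term b (h v))"
      if "continuous_on D h" "\<And>v. v \<in> D \<Longrightarrow> h v \<ge> 0" for h
      by (rule continuous_on_compose2[OF continuous_on_ent_term[OF b] that(1)])
         (simp add: image_subset_iff that(2))
    have nn: "fst v $ x \<ge> 0" "snd v $ y $ r \<ge> 0" if "v \<in> D" for v x y r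
      using that by (auto simp: D_def simplex_vec_def)
    show ?thesis
      unfolding G_def case_prod_unfold
      by (intro continuous_intros ent sum_nonneg mult_nonneg_nonneg nn) auto
  qed
  ultimately show ?thesis by (simp add: compact_continuous_image)
qed

text \<open>The ambient space has dimension |X| + 3, and all points lie on the hyperplane on which
  the coordinates of the law of X sum to 1.\<close>

lemma aff_dim_letter_points:
  fixes C :: "'x::finite \<Rightarrow> ('y::finite \<times> 'z::finite) pmf"
  shows "aff_dim (letter_points b C g) \<le> int CARD('x) + 2"
proof -
  let ?a = "((\<chi> x. 1), 0, 0, 0) :: 'x point"
  have "letter_points b C g \<subseteq> {v. ?a \<bullet> v = 1}"
    by (auto simp: letter_points_def letter_point_def vec_of_pmf_def inner_vec_def sum_pmf_eq_1)
  then have "aff_dim (letter_points b C g) \<le> aff_dim {v. ?a \<bullet> v = 1}"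
    by (rule aff_dim_subset)
  also have "?a \<noteq> 0" by (auto simp: zero_prod_def vec_eq_iff)
  then have "aff_dim {v. ?a \<bullet> v = 1} = int CARD('x) + 2"
    by (subst aff_dim_hyperplane) auto
  finally show ?thesis .
qed

lemma cond_entropy_map_pmf:
  fixes X :: "'s \<Rightarrow> 'a::countable" and Y :: "'s \<Rightarrow> 'b::countable"
  assumes "b > 1"
  shows "cond_entropy_pmf b (map_pmf f p) X Y = cond_entropy_pmf b p (\<lambda>s. X (f s)) (\<lambda>s. Y (f s))"
  by (simp add: cond_entropy_pmf_eq[OF assms] pmf.map_comp o_def expectation_map_pmf)

definition joint_point ::
  "real \<Rightarrow> ('x::finite \<Rightarrow> 'y \<Rightarrow> 'r \<Rightarrow> real) \<Rightarrow> ('x \<times> 'y \<times> 'z \<times> nat \<times> 'r) pmf \<Rightarrow> 'x point"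
  where
  "joint_point b g J =
     (vec_of_pmf (map_pmf (\<lambda>(x, y, z, u, r). x) J),
      cond_entropy_pmf b J (\<lambda>(x, y, z, u, r). x) (\<lambda>(x, y, z, u, r). u),
      measure_pmf.expectation J (\<lambda>(x, y, z, u, r). g x y r),
      cond_entropy_pmf b J (\<lambda>(x, y, z, u, r). r) (\<lambda>(x, y, z, u, r). (u, z)))"

text \<open>Every coordinate is an average over \<open>u\<close> of its value given
  \<open>u\<close>: total probability for the law of X and the cost,
  \<open>cond_entropy_mixture\<close> for the two entropies.\<close>

lemma joint_point_mixture_joint:
  fixes C :: "'x::finite \<Rightarrow> ('y::finite \<times> 'z::finite) pmf" and k :: "nat \<Rightarrow> 'y \<Rightarrow> 'r::finite pmf"
  assumes b: "b > 1" and fin: "finite (set_pmf lam)"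
  shows "joint_point b g (mixture_joint C lam Q k)
    = (\<Sum>u\<in>set_pmf lam. pmf lam u *\<^sub>R letter_point b C g (Q u) (k u))"
proof -
  let ?J = "mixture_joint C lam Q k"
  have x: "map_pmf (\<lambda>(x, y, z, u, r). x) ?J = bind_pmf lam Q"
    by (simp add: mixture_joint_def map_bind_pmf case_prod_unfold bind_return_pmf')
  have "pmf (bind_pmf lam Q) x = (\<Sum>u\<in>set_pmf lam. pmf lam u * pmf (Q u) x)" for x
    by (simp add: pmf_bind expectation_finite[OF fin])
  then have 1: "vec_of_pmf (map_pmf (\<lambda>(x, y, z, u, r). x) ?J)
      = (\<Sum>u\<in>set_pmf lam. pmf lam u *\<^sub>R vec_of_pmf (Q u))"
    by (simp add: x vec_of_pmf_def vec_eq_iff)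
  \<comment> \<open>A trivial second variable \<open>()\<close> lets the mixture formula for
    H(A|U,B) produce H(X|U).\<close>
  have "map_pmf (\<lambda>s. ((\<lambda>(x, y, z, u, r). u) s, (\<lambda>(x, y, z, u, r). x) s, ())) ?J
      = joint_pmf lam (\<lambda>u. map_pmf (\<lambda>x. (x, ())) (Q u))"
    by (simp add: mixture_joint_def joint_pmf_def map_bind_pmf case_prod_unfold bind_return_pmf'
        pmf.map_comp o_def map_pmf_def[of _ "Q _"] bind_assoc_pmf bind_return_pmf)
  note XU = cond_entropy_mixture[OF b fin this]
  have ent_unit: "ent b (map_pmf (\<lambda>x. (x, ())) q) = ent b q" for q :: "'x pmf"
  proof -
    have "pmf (map_pmf (\<lambda>x. (x, ())) q) v = pmf q (fst v)" for v
      using pmf_map_inj'[of "\<lambda>x. (x, ())" q "fst v"] by (cases v) (simp add: inj_def)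
    then show ?thesis
      unfolding ent_def
      by (intro sum.reindex_bij_witness[where i = "\<lambda>x. (x, ())" and j = fst]) auto
  qed
  have ent_snd_unit: "ent b (map_pmf snd (map_pmf (\<lambda>x. (x, ())) q)) = 0" for q :: "'x pmf"
    by (simp add: pmf.map_comp o_def ent_def ent_term_def UNIV_unit)
  from XU have "cond_entropy_pmf b ?J (\<lambda>(x, y, z, u, r). x) (\<lambda>s. ((\<lambda>(x, y, z, u, r). u) s, ()))
      = measure_pmf.expectation lam (\<lambda>u. ent b (map_pmf (\<lambda>x. (x, ())) (Q u))
          - ent b (map_pmf snd (map_pmf (\<lambda>x. (x, ())) (Q u))))"
    by simp
  also have "cond_entropy_pmf b ?J (\<lambda>(x, y, z, u, r). x) (\<lambda>s. ((\<lambda>(x, y, z, u, r). u) s, ()))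
      = cond_entropy_pmf b ?J (\<lambda>(x, y, z, u, r). x) (\<lambda>(x, y, z, u, r). u)"
    using cond_entropy_pmf_inj[OF b, of "\<lambda>u :: nat. (u, ())"] by (simp add: inj_def)
  also have "measure_pmf.expectation lam (\<lambda>u. ent b (map_pmf (\<lambda>x. (x, ())) (Q u))
          - ent b (map_pmf snd (map_pmf (\<lambda>x. (x, ())) (Q u))))
      = measure_pmf.expectation lam (\<lambda>u. ent b (Q u))"
    by (simp add: ent_unit ent_snd_unit)
  finally have 2: "cond_entropy_pmf b ?J (\<lambda>(x, y, z, u, r). x) (\<lambda>(x, y, z, u, r). u)
      = (\<Sum>u\<in>set_pmf lam. pmf lam u * ent b (Q u))"
    by (simp add: expectation_finite[OF fin])
  have "measure_pmf.expectation ?J (\<lambda>(x, y, z, u, r). g x y r)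
    = measure_pmf.expectation lam (\<lambda>u. measure_pmf.expectation (Q u) (\<lambda>x.
        measure_pmf.expectation (C x) (\<lambda>v. measure_pmf.expectation (k u (fst v)) (g x (fst v)))))"
    unfolding mixture_joint_def case_prod_unfold
    by (simp add: expectation_bind_finite fin)
  also have "\<dots> = (\<Sum>u\<in>set_pmf lam. pmf lam u * (\<Sum>x\<in>UNIV. \<Sum>y\<in>UNIV. \<Sum>z\<in>UNIV. \<Sum>r\<in>UNIV.
      pmf (Q u) x * pmf (C x) (y, z) * pmf (k u y) r * g x y r))"
    unfolding expectation_finite[OF fin] expectation_UNIV
    by (intro sum.cong refl arg_cong2[where f = times])
       (simp add: sum_UNIV_prod sum_distrib_left mult.assoc)
  finally have 3: "measure_pmf.expectation ?J (\<lambda>(x, y, z, u, r). g x y r) = \<dots>" .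
  have "map_pmf (\<lambda>s. ((\<lambda>(x, y, z, u, r). u) s, (\<lambda>(x, y, z, u, r). r) s, (\<lambda>(x, y, z, u, r). z) s)) ?J
      = joint_pmf lam (\<lambda>u. letter_law C (Q u) (k u))"
    by (simp add: mixture_joint_def letter_law_def joint_pmf_def map_bind_pmf case_prod_unfold)
  from cond_entropy_mixture[OF b fin this]
  have 4: "cond_entropy_pmf b ?J (\<lambda>(x, y, z, u, r). r) (\<lambda>(x, y, z, u, r). (u, z))
      = (\<Sum>u\<in>set_pmf lam. pmf lam u *
          (ent b (letter_law C (Q u) (k u)) - ent b (map_pmf snd (letter_law C (Q u) (k u)))))"
    by (simp add: expectation_finite[OF fin] case_prod_unfold)
  show ?thesis
    unfolding joint_point_def 1 2 3 4 letter_point_def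
    by (simp add: prod_eq_iff fst_sum snd_sum)
qed

text \<open>Bayes' rule: forward and backward channel describe the same law of (X, U), and the
  remaining factors agree.\<close>

lemma single_letter_joint_eq_mixture_joint:
  fixes P :: "('x \<times> 'y \<times> 'z) pmf"
  assumes C: "P = joint_pmf (map_pmf fst P) C"
    and "map_pmf prod.swap (joint_pmf (map_pmf fst P) PU) = joint_pmf lam Q"
  shows "single_letter_joint P PU PR = mixture_joint C lam Q PR"
proof (rule pmf_eqI)
  fix v :: "'x \<times> 'y \<times> 'z \<times> nat \<times> 'a"
  obtain x y z u r where v: "v = (x, y, z, u, r)" by (cases v)
  have "pmf (map_pmf fst P) x * pmf (PU x) u = pmf lam u * pmf (Q u) x"
    using pmf_map_inj'[of prod.swap "joint_pmf (map_pmf fst P) PU" "(x, u)"] assms(2)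
    by (simp add: pmf_joint_pmf)
  moreover have "pmf P (x, y, z) = pmf (map_pmf fst P) x * pmf (C x) (y, z)"
    by (subst C) (simp add: pmf_joint_pmf)
  ultimately show "pmf (single_letter_joint P PU PR) v = pmf (mixture_joint C lam Q PR) v"
    by (simp add: v pmf_single_letter_joint pmf_mixture_joint mult_ac)
qed

lemma single_letter_marginals:
  shows "map_pmf (\<lambda>(x, y, z, u, r). x) (single_letter_joint P PU PR) = map_pmf fst P"
    and "map_pmf (\<lambda>(x, y, z, u, r). (x, u)) (single_letter_joint P PU PR)
      = joint_pmf (map_pmf fst P) PU"
  by (simp_all add: single_letter_joint_def joint_pmf_def map_bind_pmf bind_map_pmf case_prod_unfold
      map_pmf_def[of _ P] map_pmf_def[of _ "PU _"] bind_assoc_pmf bind_return_pmf)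

lemma joint_point_in_convex_hull:
  fixes P :: "('x::finite \<times> 'y::finite \<times> 'z::finite) pmf" and PR :: "nat \<Rightarrow> 'y \<Rightarrow> 'r::finite pmf"
  assumes b: "b > 1" and C: "P = joint_pmf (map_pmf fst P) C"
    and fin: "\<And>x. finite (set_pmf (PU x))"
  shows "joint_point b g (single_letter_joint P PU PR) \<in> convex hull (letter_points b C g)"
proof -
  define q where "q = map_pmf prod.swap (joint_pmf (map_pmf fst P) PU)"
  have finq: "finite (set_pmf q)" using fin by (auto simp: q_def joint_pmf_def)
  obtain Q where Q: "q = joint_pmf (map_pmf fst q) Q" using ex_disintegration[of q] ..
  have "single_letter_joint P PU PR = mixture_joint C (map_pmf fst q) Q PR"
    unfolding q_def by (rule single_letter_joint_eq_mixture_joint[OF C Q[unfolded q_def]])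
  moreover have "(\<Sum>u\<in>set_pmf (map_pmf fst q). pmf (map_pmf fst q) u *\<^sub>R letter_point b C g (Q u) (PR u))
      \<in> convex hull (letter_points b C g)"
    using finq by (intro convex_sum convex_convex_hull hull_inc sum_pmf_eq_1)
      (auto simp: letter_points_def)
  moreover have "finite (set_pmf (map_pmf fst q))" using finq by simp
  ultimately show ?thesis by (simp only: joint_point_mixture_joint[OF b])
qed

text \<open>The weights of a Caratheodory combination become the law of U, its points supply the
  backward channel and the decoder, and reversing the backward channel gives a test channel for the
  prescribed source.\<close>

lemma convex_hull_attained:
  fixes P :: "('x::finite \<times> 'y::finite \<times> 'z::finite) pmf" and g :: "'x \<Rightarrow> 'y \<Rightarrow> 'r::finite \<Rightarrow> real"
  assumes b: "b > 1" and C: "P = joint_pmf (map_pmf fst P) C"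
    and v: "v \<in> convex hull (letter_points b C g)" and v1: "fst v = vec_of_pmf (map_pmf fst P)"
  obtains U PU PR where "finite U" "card U \<le> CARD('x) + 3" "\<And>x. set_pmf (PU x) \<subseteq> U"
    "v = joint_point b g (single_letter_joint P PU PR)"
proof -
  obtain S where S: "finite S" "S \<subseteq> letter_points b C g"
      "int (card S) \<le> aff_dim (letter_points b C g) + 1" "v \<in> convex hull S"
    using v unfolding caratheodory_aff_dim[of "letter_points b C g"] by blast
  from S(4) obtain w where w: "\<And>s. s \<in> S \<Longrightarrow> 0 \<le> w s" "sum w S = 1" "(\<Sum>s\<in>S. w s *\<^sub>R s) = v"
    unfolding convex_hull_finite[OF S(1)] by blast
  define m where "m = card S"
  obtain h where h: "bij_betw h {..<m} S"
    using ex_bij_betw_nat_finite[OF S(1)] by (auto simp: m_def atLeast0LessThan)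
  have "\<exists>q k. s = letter_point b C g q k" if "s \<in> S" for s
    using subsetD[OF S(2) that] by (auto simp: letter_points_def)
  then obtain Q' k' where Q': "\<And>s. s \<in> S \<Longrightarrow> s = letter_point b C g (Q' s) (k' s)"
    by metis
  define lam where "lam = embed_pmf (\<lambda>u. if u < m then w (h u) else 0)"
  have hS: "h u \<in> S" if "u < m" for u using h that by (auto simp: bij_betw_def)
  have lam: "pmf lam u = (if u < m then w (h u) else 0)" for u
    unfolding lam_def
  proof (rule pmf_embed_pmf)
    have "(\<integral>\<^sup>+u. ennreal (if u < m then w (h u) else 0) \<partial>count_space UNIV)
        = (\<Sum>u<m. ennreal (if u < m then w (h u) else 0))"
      by (rule nn_integral_count_space') auto
    also have "\<dots> = ennreal (\<Sum>u<m. w (h u))"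
      using w(1) hS by (subst sum_ennreal[symmetric]) auto
    also have "(\<Sum>u<m. w (h u)) = 1"
      using sum.reindex_bij_betw[OF h, of w] w(2) by simp
    finally show "(\<integral>\<^sup>+u. ennreal (if u < m then w (h u) else 0) \<partial>count_space UNIV) = 1" by simp
  qed (use w(1) hS in auto)
  have sub: "set_pmf lam \<subseteq> {..<m}" by (auto simp: set_pmf_iff lam split: if_splits)
  have fin: "finite (set_pmf lam)" using sub finite_subset by blast
  define Q k where "Q = Q' \<circ> h" and "k = k' \<circ> h"
  have "joint_point b g (mixture_joint C lam Q k)
      = (\<Sum>u\<in>set_pmf lam. pmf lam u *\<^sub>R letter_point b C g (Q u) (k u))"
    by (rule joint_point_mixture_joint[OF b fin])
  also have "\<dots> = (\<Sum>u<m. pmf lam u *\<^sub>R letter_point b C g (Q u) (k u))"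
    using sub by (intro sum.mono_neutral_left) (auto simp: set_pmf_iff)
  also have "\<dots> = (\<Sum>u<m. w (h u) *\<^sub>R h u)"
    using Q' hS by (intro sum.cong) (auto simp: lam Q_def k_def)
  also have "\<dots> = v"
    using sum.reindex_bij_betw[OF h, of "\<lambda>s. w s *\<^sub>R s"] w(3) by simp
  finally have pt: "joint_point b g (mixture_joint C lam Q k) = v" .
  have "map_pmf (\<lambda>(x, y, z, u, r). x) (mixture_joint C lam Q k) = bind_pmf lam Q"
    by (simp add: mixture_joint_def map_bind_pmf case_prod_unfold bind_return_pmf')
  \<comment> \<open>The law of X is kept as a coordinate for this purpose: it forces the mixture to
    have the given source marginal.\<close>
  then have "vec_of_pmf (bind_pmf lam Q) = vec_of_pmf (map_pmf fst P)"
    using arg_cong[OF pt, of fst] v1 by (simp add: joint_point_def)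
  then have "bind_pmf lam Q = map_pmf fst P"
    by (intro pmf_eqI) (simp add: vec_of_pmf_def vec_eq_iff)
  define q where "q = map_pmf prod.swap (joint_pmf lam Q)"
  have "map_pmf fst q = map_pmf fst P"
    unfolding \<open>bind_pmf lam Q = map_pmf fst P\<close>[symmetric]
    by (simp add: q_def joint_pmf_def map_bind_pmf pmf.map_comp o_def)
  then obtain PU where PU: "q = joint_pmf (map_pmf fst P) PU" "\<And>x. set_pmf (PU x) \<subseteq> snd ` set_pmf q"
    using disintegration[of q] by metis
  have "map_pmf prod.swap q = joint_pmf lam Q"
    by (simp add: q_def pmf.map_comp o_def)
  then have "single_letter_joint P PU k = mixture_joint C lam Q k"
    using PU(1) by (intro single_letter_joint_eq_mixture_joint[OF C]) simp
  moreover have "snd ` set_pmf q \<subseteq> {..<m}"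
    using sub by (auto simp: q_def joint_pmf_def)
  then have "set_pmf (PU x) \<subseteq> {..<m}" for x
    using PU(2) by blast
  moreover have "m \<le> CARD('x) + 3"
    using S(3) aff_dim_letter_points[of b C g] by (simp add: m_def)
  ultimately show ?thesis
    using that[of "{..<m}" PU k] pt by simp
qed

section \<open>Converse\<close>

text \<open>Chain rule and dropping of conditions in a single use of Gibbs' inequality: the guess
  for the block is the product of the true conditional laws of each entry given the part
  \<open>h i\<close> of \<open>Y\<close> that is retained at position \<open>i\<close>.\<close>

lemma cond_entropy_list_le:
  fixes Xs :: "'s \<Rightarrow> 'a::finite list" and Y :: "'s \<Rightarrow> 'b::countable" and h :: "nat \<Rightarrow> 'b \<Rightarrow> 'c::countable"
  assumes b: "b > 1" and fin: "finite (set_pmf p)"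
    and len: "\<And>s. s \<in> set_pmf p \<Longrightarrow> length (Xs s) = n"
  shows "cond_entropy_pmf b p Xs Y \<le> (\<Sum>i<n. cond_entropy_pmf b p (\<lambda>s. Xs s ! i) (\<lambda>s. h i (Y s)))"
proof -
  have "\<exists>\<kappa>. map_pmf (\<lambda>s. (h i (Y s), Xs s ! i)) p = joint_pmf (map_pmf (\<lambda>s. h i (Y s)) p) \<kappa>" for i
  proof -
    let ?q = "map_pmf (\<lambda>s. (h i (Y s), Xs s ! i)) p"
    have "map_pmf fst ?q = map_pmf (\<lambda>s. h i (Y s)) p" by (simp add: pmf.map_comp o_def)
    with ex_disintegration[of ?q] show ?thesis by (simp only:)
  qed
  then obtain \<kappa> where \<kappa>:
    "\<And>i. map_pmf (\<lambda>s. (h i (Y s), Xs s ! i)) p = joint_pmf (map_pmf (\<lambda>s. h i (Y s)) p) (\<kappa> i)"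
    by metis
  have swap: "pmf (map_pmf (\<lambda>s. (Xs s ! i, h i (Y s))) p) (x, y)
      = pmf (map_pmf (\<lambda>s. h i (Y s)) p) y * pmf (\<kappa> i y) x" for i x y
  proof -
    have "map_pmf (\<lambda>s. (Xs s ! i, h i (Y s))) p
        = map_pmf prod.swap (map_pmf (\<lambda>s. (h i (Y s), Xs s ! i)) p)"
      by (simp add: pmf.map_comp o_def)
    then show ?thesis
      using pmf_map_inj'[of prod.swap "joint_pmf (map_pmf (\<lambda>s. h i (Y s)) p) (\<kappa> i)" "(y, x)"]
      by (simp add: \<kappa> pmf_joint_pmf)
  qed
  have pos: "pmf (\<kappa> i (h i (Y s))) (Xs s ! i) > 0" if "s \<in> set_pmf p" for s i
  proof -
    have "pmf (map_pmf (\<lambda>s. (Xs s ! i, h i (Y s))) p) (Xs s ! i, h i (Y s)) > 0"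
      using that by (intro pmf_positive) auto
    then show ?thesis unfolding swap by (simp add: zero_less_mult_iff)
  qed
  define K where "K = (\<lambda>y. product_list_pmf n (\<lambda>i. \<kappa> i (h i y)))"
  have K: "pmf (K (Y s)) (Xs s) = (\<Prod>i<n. pmf (\<kappa> i (h i (Y s))) (Xs s ! i))" if "s \<in> set_pmf p" for s
    using len[OF that] by (simp add: K_def pmf_product_list_pmf)
  have "measure_pmf.expectation p (\<lambda>s. log b (pmf (K (Y s)) (Xs s))) \<le> - cond_entropy_pmf b p Xs Y"
    unfolding cond_entropy_pmf_eq[OF b] minus_minus
    by (rule gibbs_conditional[OF b fin]) (use K pos in \<open>auto intro: prod_pos\<close>)
  also have "measure_pmf.expectation p (\<lambda>s. log b (pmf (K (Y s)) (Xs s)))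
      = measure_pmf.expectation p (\<lambda>s. \<Sum>i<n. log b (pmf (\<kappa> i (h i (Y s))) (Xs s ! i)))"
  proof (intro expectation_cong)
    fix s assume "s \<in> set_pmf p"
    then show "log b (pmf (K (Y s)) (Xs s)) = (\<Sum>i<n. log b (pmf (\<kappa> i (h i (Y s))) (Xs s ! i)))"
      using pos[of s] by (simp add: K log_prod_positive)
  qed
  also have "\<dots> = (\<Sum>i<n. - cond_entropy_pmf b p (\<lambda>s. Xs s ! i) (\<lambda>s. h i (Y s)))"
    unfolding expectation_sum[OF fin] cond_entropy_pmf_eq[OF b] minus_minus swap
  proof (intro sum.cong refl expectation_cong)
    fix i s assume s: "s \<in> set_pmf p"
    then have "pmf (map_pmf (\<lambda>s. h i (Y s)) p) (h i (Y s)) > 0" by (intro pmf_positive) auto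
    then show "log b (pmf (\<kappa> i (h i (Y s))) (Xs s ! i)) =
        log b (pmf (map_pmf (\<lambda>s. h i (Y s)) p) (h i (Y s)) * pmf (\<kappa> i (h i (Y s))) (Xs s ! i)
               / pmf (map_pmf (\<lambda>s. h i (Y s)) p) (h i (Y s)))"
      by simp
  qed
  finally show ?thesis by (simp add: sum_negf)
qed

lemma expectation_code_joint_sum:
  fixes P :: "('x::finite \<times> 'y::finite \<times> 'z::finite) pmf" and c :: "('x, 'y, 'r::finite) code"
    and \<phi> :: "nat \<Rightarrow> 'x \<times> 'y \<times> 'z \<times> nat \<times> 'r \<Rightarrow> real"
  shows "measure_pmf.expectation (code_joint P n c)
      (\<lambda>(xs, ys, zs, w, rs). \<Sum>i<n. \<phi> i (xs ! i, ys ! i, zs ! i, w, rs ! i))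
    = (\<Sum>i<n. measure_pmf.expectation
        (single_letter_joint P (message_kernel (map_pmf fst P) n (enc c) i) (dec c i)) (\<phi> i))"
proof -
  have "measure_pmf.expectation (code_joint P n c)
      (\<lambda>(xs, ys, zs, w, rs). \<Sum>i<n. \<phi> i (xs ! i, ys ! i, zs ! i, w, rs ! i))
    = (\<Sum>i<n. measure_pmf.expectation (code_joint P n c)
      (\<lambda>s. \<phi> i ((\<lambda>(xs, ys, zs, w, rs). (xs ! i, ys ! i, zs ! i, w, rs ! i)) s)))"
    unfolding case_prod_unfold by (rule expectation_sum[OF finite_code_joint])
  also have "\<dots> = (\<Sum>i<n. measure_pmf.expectation
        (single_letter_joint P (message_kernel (map_pmf fst P) n (enc c) i) (dec c i)) (\<phi> i))"
    by (intro sum.cong refl) (simp add: code_joint_marginal[symmetric] expectation_map_pmf)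
  finally show ?thesis .
qed

lemma finite_message_kernel:
  fixes p :: "'x::finite pmf"
  shows "finite (set_pmf (message_kernel p n f i x))"
  by (simp add: message_kernel_def finite_set_replicate_pmf)

text \<open>Since the message is a function of the block, the left side is the entropy of the
  message, and Gibbs' inequality against the uniform law on \<open>M\<close> bounds that by the
  logarithm of the size.\<close>

lemma source_entropy_le:
  fixes p :: "'x::finite pmf" and f :: "'x list \<Rightarrow> nat"
  assumes b: "b > 1" and M: "finite M" and f: "f \<in> {xs. length xs = n} \<rightarrow> M"
  shows "real n * ent b p - cond_entropy_pmf b (replicate_pmf n p) (\<lambda>xs. xs) f \<le> log b (card M)"
proof -
  let ?R = "replicate_pmf n p"
  have fin: "finite (set_pmf ?R)" by (simp add: finite_set_replicate_pmf)
  have len: "length xs = n" if "xs \<in> set_pmf ?R" for xs using that by (simp add: set_replicate_pmf)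
  \<comment> \<open>Some list of length \<open>n\<close> exists, and its message lies in
    \<open>M\<close>.\<close>
  have "M \<noteq> {}" using f by (auto intro: Ex_list_of_length simp: Pi_iff) (metis Ex_list_of_length empty_iff)
  have fM: "f xs \<in> M" if "xs \<in> set_pmf ?R" for xs using f len[OF that] by auto
  have inj: "inj (\<lambda>xs. (xs, f xs))" by (auto simp: inj_def)
  have graph: "pmf (map_pmf (\<lambda>xs. (xs, f xs)) ?R) (xs, f xs) = pmf ?R xs" for xs
    using pmf_map_inj'[OF inj, of ?R xs] by simp
  have "- cond_entropy_pmf b ?R (\<lambda>xs. xs) f
      = measure_pmf.expectation ?R (\<lambda>xs. log b (pmf ?R xs) - log b (pmf (map_pmf f ?R) (f xs)))"
    unfolding cond_entropy_pmf_eq[OF b] minus_minus graph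
  proof (intro expectation_cong)
    fix xs assume xs: "xs \<in> set_pmf ?R"
    then have "pmf (map_pmf f ?R) (f xs) > 0" by (intro pmf_positive) auto
    then show "log b (pmf ?R xs / pmf (map_pmf f ?R) (f xs))
        = log b (pmf ?R xs) - log b (pmf (map_pmf f ?R) (f xs))"
      using pmf_positive[OF xs] b by (simp add: log_divide)
  qed
  also have "\<dots> = measure_pmf.expectation ?R (\<lambda>xs. log b (pmf ?R xs))
      - measure_pmf.expectation ?R (\<lambda>xs. log b (pmf (map_pmf f ?R) (f xs)))"
    by (rule expectation_diff[OF fin])
  also have "measure_pmf.expectation ?R (\<lambda>xs. log b (pmf ?R xs))
      = measure_pmf.expectation ?R (\<lambda>xs. \<Sum>i<n. log b (pmf p (xs ! i)))"
  proof (intro expectation_cong)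
    fix xs assume xs: "xs \<in> set_pmf ?R"
    then have "pmf p (xs ! i) > 0" if "i < n" for i
      using that by (intro pmf_positive) (auto simp: set_replicate_pmf)
    then show "log b (pmf ?R xs) = (\<Sum>i<n. log b (pmf p (xs ! i)))"
      unfolding pmf_replicate_pmf[OF len[OF xs]] by (intro log_prod_positive) auto
  qed
  also have "\<dots> = (\<Sum>i<n. measure_pmf.expectation (map_pmf (\<lambda>xs. xs ! i) ?R) (\<lambda>x. log b (pmf p x)))"
    by (simp add: expectation_sum[OF fin] expectation_map_pmf)
  also have "\<dots> = (\<Sum>i<n. - ent b p)"
  proof (intro sum.cong refl)
    fix i assume "i \<in> {..<n}"
    then have "map_pmf (\<lambda>xs. xs ! i) ?R = p"
      using arg_cong[OF replicate_marginal[of i n f p], of "map_pmf fst"]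
      by (simp add: pmf.map_comp o_def map_fst_joint_pmf)
    then show "measure_pmf.expectation (map_pmf (\<lambda>xs. xs ! i) ?R) (\<lambda>x. log b (pmf p x)) = - ent b p"
      by (simp add: ent_eq_expectation)
  qed
  finally have eq: "real n * ent b p - cond_entropy_pmf b ?R (\<lambda>xs. xs) f
      = - measure_pmf.expectation ?R (\<lambda>xs. log b (pmf (map_pmf f ?R) (f xs)))"
    by simp
  have unit: "map_pmf (\<lambda>_. ()) ?R = return_pmf ()"
    by (simp add: map_pmf_const)
  have unit': "pmf (map_pmf (\<lambda>xs. (f xs, ())) ?R) (w, ()) = pmf (map_pmf f ?R) w" for w
    using pmf_map_inj'[of "\<lambda>w. (w, ())" "map_pmf f ?R" w] by (simp add: inj_def pmf.map_comp o_def)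
  have "measure_pmf.expectation ?R (\<lambda>xs. - log b (card M))
      = measure_pmf.expectation ?R (\<lambda>xs. log b (pmf (pmf_of_set M) (f xs)))"
    using M \<open>M \<noteq> {}\<close> fM b
    by (intro expectation_cong) (auto simp: log_divide card_gt_0_iff)
  also have "\<dots> \<le> measure_pmf.expectation ?R (\<lambda>xs. log b (pmf (map_pmf (\<lambda>xs. (f xs, ())) ?R) (f xs, ())
          / pmf (map_pmf (\<lambda>_. ()) ?R) ()))"
    by (rule gibbs_conditional[OF b fin, of "\<lambda>_. pmf_of_set M" "\<lambda>_. ()" f])
       (use M \<open>M \<noteq> {}\<close> fM in \<open>auto simp: card_gt_0_iff\<close>)
  finally show ?thesis by (simp add: unit unit' eq)
qed

text \<open>The witness is the uniform average of the joint points of the \<open>n\<close>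
  positions. All positions share the law of X, so averaging keeps the first coordinate and replaces
  a time-sharing variable.\<close>

lemma code_point:
  fixes P :: "('x::finite \<times> 'y::finite \<times> 'z::finite) pmf" and F :: "'x \<Rightarrow> 'y \<Rightarrow> 'f"
    and d :: "'f \<Rightarrow> 'r::finite \<Rightarrow> real" and c :: "('x, 'y, 'r) code"
  assumes b: "b > 1" and C: "P = joint_pmf (map_pmf fst P) C" and n: "n > 0" and c: "is_code n c"
  obtains v where "v \<in> convex hull (letter_points b C (\<lambda>x y. d (F x y)))"
    "fst v = vec_of_pmf (map_pmf fst P)"
    "ent b (map_pmf fst P) - fst (snd v) \<le> 1 / real n * log b (card (msgs c))"
    "fst (snd (snd v)) = code_distortion P F d n c"
    "code_equivocation b P n c \<le> snd (snd (snd v))"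
proof -
  define p where "p = map_pmf fst P"
  define J where "J = code_joint P n c"
  define S where "S = (\<lambda>i. single_letter_joint P (message_kernel p n (enc c) i) (dec c i))"
  define v where "v = (\<Sum>i<n. (1 / real n) *\<^sub>R joint_point b (\<lambda>x y. d (F x y)) (S i))"
  have finJ: "finite (set_pmf J)" by (simp add: J_def finite_code_joint)
  have "v \<in> convex hull (letter_points b C (\<lambda>x y. d (F x y)))"
    unfolding v_def S_def using n
    by (intro convex_sum convex_convex_hull joint_point_in_convex_hull b C finite_message_kernel) auto
  moreover have "fst v = vec_of_pmf p"
  proof -
    have "fst v = (\<Sum>i<n. (1 / real n) *\<^sub>R vec_of_pmf p)"
      by (simp add: v_def fst_sum joint_point_def S_def single_letter_marginals p_def del: sum_constant)
    also have "\<dots> = vec_of_pmf p"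
      unfolding scaleR_left.sum[symmetric] using n by simp
    finally show ?thesis .
  qed
  moreover have "ent b p - fst (snd v) \<le> 1 / real n * log b (card (msgs c))"
  proof -
    let ?R = "replicate_pmf n p"
    have fin: "finite (set_pmf ?R)" by (simp add: finite_set_replicate_pmf)
    have "cond_entropy_pmf b ?R (\<lambda>xs. xs) (enc c)
        \<le> (\<Sum>i<n. cond_entropy_pmf b ?R (\<lambda>xs. xs ! i) (enc c))"
      using cond_entropy_list_le[OF b fin, of "\<lambda>xs. xs" n "enc c" "\<lambda>_ w. w"]
      by (simp add: set_replicate_pmf)
    also have "\<dots> = (\<Sum>i<n. cond_entropy_pmf b (S i) (\<lambda>(x, y, z, u, r). x) (\<lambda>(x, y, z, u, r). u))"
    proof (intro sum.cong refl)
      fix i assume "i \<in> {..<n}"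
      then have i: "i < n" by simp
      have "cond_entropy_pmf b ?R (\<lambda>xs. xs ! i) (enc c)
          = cond_entropy_pmf b (map_pmf (\<lambda>xs. (xs ! i, enc c xs)) ?R) fst snd"
        by (simp add: cond_entropy_map_pmf[OF b])
      also have "\<dots> = cond_entropy_pmf b (map_pmf (\<lambda>(x, y, z, u, r). (x, u)) (S i)) fst snd"
        by (simp add: replicate_marginal[OF i] S_def single_letter_marginals p_def)
      also have "\<dots> = cond_entropy_pmf b (S i) (\<lambda>(x, y, z, u, r). x) (\<lambda>(x, y, z, u, r). u)"
        by (simp add: cond_entropy_map_pmf[OF b] case_prod_unfold)
      finally show "cond_entropy_pmf b ?R (\<lambda>xs. xs ! i) (enc c) = \<dots>" .
    qed
    also have "\<dots> = real n * fst (snd v)"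
      using n by (simp add: v_def fst_sum snd_sum joint_point_def sum_distrib_left)
    finally have "real n * (ent b p - fst (snd v)) \<le> log b (card (msgs c))"
      using source_entropy_le[OF b, of "msgs c" "enc c" n p] c
      by (simp add: is_code_def right_diff_distrib)
    then show ?thesis using n by (simp add: field_simps)
  qed
  moreover have "fst (snd (snd v)) = code_distortion P F d n c"
  proof -
    have "measure_pmf.expectation J (\<lambda>(xs, ys, zs, w, rs). \<Sum>i<n. d (F (xs ! i) (ys ! i)) (rs ! i))
        = (\<Sum>i<n. measure_pmf.expectation (S i) (\<lambda>(x, y, z, u, r). d (F x y) r))"
      using expectation_code_joint_sum[of P n c "\<lambda>i (x, y, z, u, r). d (F x y) r"]
      by (simp add: J_def S_def p_def)
    then have "code_distortion P F d n c
        = (\<Sum>i<n. measure_pmf.expectation (S i) (\<lambda>(x, y, z, u, r). d (F x y) r)) / real n"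
      by (simp add: code_distortion_def distortion_def J_def case_prod_unfold)
    also have "\<dots> = fst (snd (snd v))"
      by (simp add: v_def fst_sum snd_sum joint_point_def sum_divide_distrib)
    finally show ?thesis ..
  qed
  moreover have "code_equivocation b P n c \<le> snd (snd (snd v))"
  proof -
    let ?Y = "\<lambda>(xs :: 'x list, ys :: 'y list, zs :: 'z list, w :: nat, rs :: 'r list). (w, zs)"
    \<comment> \<open>At position \<open>i\<close> the message and only the \<open>i\<close>-th
      letter of the eavesdropper's block are retained.\<close>
    let ?h = "\<lambda>i (w :: nat, zs :: 'z list). (w, zs ! i)"
    have "cond_entropy_pmf b J (\<lambda>(xs, ys, zs, w, rs). rs) ?Y
        \<le> (\<Sum>i<n. cond_entropy_pmf b J (\<lambda>s. (\<lambda>(xs, ys, zs, w, rs). rs) s ! i) (\<lambda>s. ?h i (?Y s)))"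
      by (rule cond_entropy_list_le[OF b finJ]) (auto simp: J_def elim!: set_code_joint)
    also have "\<dots> = (\<Sum>i<n. cond_entropy_pmf b (S i) (\<lambda>(x, y, z, u, r). r) (\<lambda>(x, y, z, u, r). (u, z)))"
      by (intro sum.cong refl)
         (simp add: S_def p_def J_def code_joint_marginal[symmetric] cond_entropy_map_pmf[OF b]
            case_prod_unfold)
    finally show ?thesis
      using n by (simp add: code_equivocation_def J_def[symmetric] v_def snd_sum joint_point_def
          sum_divide_distrib[symmetric] divide_right_mono)
  qed
  ultimately show ?thesis using that[of v] by (simp add: p_def)
qed

text \<open>Compactness of the convex hull lets the slack \<open>\<delta>\<close> of achievability tend to zero.\<close>

lemma region_eve_subset:
  fixes P :: "('x::finite \<times> 'y::finite \<times> 'z::finite) pmf" and F :: "'x \<Rightarrow> 'y \<Rightarrow> 'f"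
    and d :: "'f \<Rightarrow> 'r::finite \<Rightarrow> real"
  assumes b: "b > 1"
  shows "region_eve b P F d \<subseteq> region_in_eve_causal b P F d"
proof
  fix t assume "t \<in> region_eve b P F d"
  then obtain R D E where t: "t = (R, D, E)" and nonneg: "R \<ge> 0" "D \<ge> 0" "E \<ge> 0"
    and ach: "achievable b P F d R D E"
    by (auto simp: region_eve_def)
  obtain C where C: "P = joint_pmf (map_pmf fst P) C" using ex_disintegration[of P] ..
  define g where "g = (\<lambda>x y. d (F x y))"
  define p where "p = map_pmf fst P"
  define K where "K = convex hull (letter_points b C g)"
  have K: "compact K" by (simp add: K_def compact_convex_hull compact_letter_points b)
  have "\<exists>v\<in>K. fst v = vec_of_pmf p \<and> ent b p - fst (snd v) \<le> R + \<delta> \<and>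
      fst (snd (snd v)) \<le> D + \<delta> \<and> E - \<delta> \<le> snd (snd (snd v))" if "\<delta> > 0" for \<delta>
  proof -
    have "\<forall>\<^sub>F n in sequentially. \<exists>c :: ('x, 'y, 'r) code. is_code n c \<and>
        1 / real n * log b (real (card (msgs c))) \<le> R + \<delta> \<and>
        code_distortion P F d n c \<le> D + \<delta> \<and> code_equivocation b P n c \<ge> E - \<delta>"
      using ach that by (simp add: achievable_def)
    from eventually_happens'[OF sequentially_bot eventually_conj[OF this eventually_gt_at_top[of 0]]]
    obtain n and c :: "('x, 'y, 'r) code" where n: "n > 0" and c: "is_code n c"
      "1 / real n * log b (real (card (msgs c))) \<le> R + \<delta>"
      "code_distortion P F d n c \<le> D + \<delta>" "code_equivocation b P n c \<ge> E - \<delta>"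
      by blast
    obtain v where "v \<in> convex hull (letter_points b C (\<lambda>x y. d (F x y)))"
      "fst v = vec_of_pmf (map_pmf fst P)"
      "ent b (map_pmf fst P) - fst (snd v) \<le> 1 / real n * log b (card (msgs c))"
      "fst (snd (snd v)) = code_distortion P F d n c"
      "code_equivocation b P n c \<le> snd (snd (snd v))"
      by (rule code_point[OF b C n c(1)])
    with c show ?thesis unfolding K_def g_def p_def by (intro bexI[of _ v]) auto
  qed
  then have "\<exists>v\<in>K. fst v = vec_of_pmf p \<and> ent b p - fst (snd v) \<le> R + inverse (real (Suc k)) \<and>
      fst (snd (snd v)) \<le> D + inverse (real (Suc k)) \<and> E - inverse (real (Suc k)) \<le> snd (snd (snd v))" for k
    by simp
  then obtain v where v: "\<And>k. v k \<in> K" "\<And>k. fst (v k) = vec_of_pmf p"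
    "\<And>k. ent b p - fst (snd (v k)) \<le> R + inverse (real (Suc k))"
    "\<And>k. fst (snd (snd (v k))) \<le> D + inverse (real (Suc k))"
    "\<And>k. E - inverse (real (Suc k)) \<le> snd (snd (snd (v k)))"
    by metis
  obtain l \<sigma> where l: "l \<in> K" and \<sigma>: "strict_mono \<sigma>" and lim: "(v \<circ> \<sigma>) \<longlonglongrightarrow> l"
    using K v(1) unfolding compact_def by metis
  have inv: "(\<lambda>k. inverse (real (Suc (\<sigma> k)))) \<longlonglongrightarrow> 0"
    using LIMSEQ_subseq_LIMSEQ[OF LIMSEQ_inverse_real_of_nat \<sigma>] by (simp add: o_def)
  have lim': "(\<lambda>k. v (\<sigma> k)) \<longlonglongrightarrow> l" using lim by (simp add: o_def)
  \<comment> \<open>All points of the sequence carry the same law of X, so the limit still belongs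
    to the given source.\<close>
  have "(\<lambda>k. fst (v (\<sigma> k))) \<longlonglongrightarrow> fst l" by (intro tendsto_intros lim')
  then have l1: "fst l = vec_of_pmf p" by (simp add: v(2) LIMSEQ_const_iff)
  have slack: "(\<lambda>k. a + inverse (real (Suc (\<sigma> k)))) \<longlonglongrightarrow> a" for a
    using tendsto_add[OF tendsto_const inv, of a] by simp
  have "(\<lambda>k. ent b p - fst (snd (v (\<sigma> k)))) \<longlonglongrightarrow> ent b p - fst (snd l)"
    by (intro tendsto_intros lim')
  from LIMSEQ_le[OF this slack] have "ent b p - fst (snd l) \<le> R" using v(3) by blast
  moreover have "(\<lambda>k. fst (snd (snd (v (\<sigma> k))))) \<longlonglongrightarrow> fst (snd (snd l))"
    by (intro tendsto_intros lim')
  from LIMSEQ_le[OF this slack] have "fst (snd (snd l)) \<le> D" using v(4) by blast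
  moreover have "(\<lambda>k. snd (snd (snd (v (\<sigma> k))))) \<longlonglongrightarrow> snd (snd (snd l))"
    by (intro tendsto_intros lim')
  from LIMSEQ_le[OF tendsto_const tendsto_add[OF this inv], of E]
  have "E \<le> snd (snd (snd l))" using v(5) by (force simp: algebra_simps)
  moreover obtain U PU PR where U: "finite U" "card U \<le> CARD('x) + 3" "\<And>x. set_pmf (PU x) \<subseteq> U"
    and pt: "l = joint_point b g (single_letter_joint P PU PR)"
    using convex_hull_attained[OF b C l[unfolded K_def] l1[unfolded p_def]] by metis
  moreover have "finite (set_pmf (single_letter_joint P PU PR))"
    using U finite_subset by (intro finite_single_letter_joint) blast
  then have "mutual_info_pmf b (single_letter_joint P PU PR) (\<lambda>(x, y, z, u, r). x) (\<lambda>(x, y, z, u, r). u)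
      = ent b p - fst (snd l)"
    unfolding p_def pt by (simp add: mutual_info_pmf_eq_ent[OF b] single_letter_marginals joint_point_def)
  ultimately have "R \<ge> mutual_info_pmf b (single_letter_joint P PU PR) (\<lambda>(x, y, z, u, r). x) (\<lambda>(x, y, z, u, r). u)
     \<and> D \<ge> measure_pmf.expectation (single_letter_joint P PU PR) (\<lambda>(x, y, z, u, r). d (F x y) r)
     \<and> E \<le> cond_entropy_pmf b (single_letter_joint P PU PR) (\<lambda>(x, y, z, u, r). r) (\<lambda>(x, y, z, u, r). (u, z))"
    by (simp add: joint_point_def g_def)
  with nonneg U show "t \<in> region_in_eve_causal b P F d"
    unfolding region_in_eve_causal_def t Let_def by blast
qed

section \<open>Covering\<close>

text \<open>Independence and mean zero remove the cross terms when one letter is split off.\<close>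

lemma replicate_pmf_second_moment:
  fixes g :: "'a \<Rightarrow> real"
  assumes fin: "finite (set_pmf p)" and mean: "measure_pmf.expectation p g = 0"
  shows "measure_pmf.expectation (replicate_pmf n p) (\<lambda>xs. (sum_list (map g xs))\<^sup>2)
      = real n * measure_pmf.expectation p (\<lambda>x. (g x)\<^sup>2)"
proof -
  have int: "integrable (measure_pmf p) h" "integrable (measure_pmf (replicate_pmf m p)) k"
    for h :: "'a \<Rightarrow> real" and k :: "'a list \<Rightarrow> real" and m
    by (simp_all add: integrable_measure_pmf_finite fin finite_set_replicate_pmf)
  have step: "measure_pmf.expectation (replicate_pmf (Suc m) p) k
      = measure_pmf.expectation p (\<lambda>x. measure_pmf.expectation (replicate_pmf m p) (\<lambda>xs. k (x # xs)))"
    for m and k :: "'a list \<Rightarrow> real"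
    by (simp add: expectation_bind_finite fin finite_set_replicate_pmf)
  have one: "measure_pmf.expectation (replicate_pmf n p) (\<lambda>xs. sum_list (map g xs)) = 0" for n
    by (induction n) (simp_all add: step int mean del: replicate_pmf.simps(2))
  show "measure_pmf.expectation (replicate_pmf n p) (\<lambda>xs. (sum_list (map g xs))\<^sup>2)
      = real n * measure_pmf.expectation p (\<lambda>x. (g x)\<^sup>2)"
    by (induction n)
       (simp_all add: step int mean one power2_sum algebra_simps del: replicate_pmf.simps(2))
qed

text \<open>Chebyshev's inequality. Typicality here bounds sums from above; a bound from below is
  obtained by applying it to the negated function.\<close>

lemma weak_law_upper:
  fixes h :: "'a \<Rightarrow> real"
  assumes fin: "finite (set_pmf p)" and \<epsilon>: "\<epsilon> > 0" and \<eta>: "\<eta> > 0"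
  shows "\<forall>\<^sub>F n in sequentially. measure (replicate_pmf n p)
    {xs. (\<Sum>i<n. h (xs ! i)) > real n * (measure_pmf.expectation p h + \<epsilon>)} \<le> \<eta>"
proof -
  define \<mu> where "\<mu> = measure_pmf.expectation p h"
  define g where "g = (\<lambda>x. h x - \<mu>)"
  define V where "V = measure_pmf.expectation p (\<lambda>x. (g x)\<^sup>2)"
  have mean: "measure_pmf.expectation p g = 0"
    by (simp add: g_def \<mu>_def expectation_diff[OF fin])
  have bound: "measure (replicate_pmf n p) {xs. (\<Sum>i<n. h (xs ! i)) > real n * (\<mu> + \<epsilon>)}
      \<le> V / (real n * \<epsilon>\<^sup>2)" if n: "n > 0" for n
  proof -
    let ?R = "replicate_pmf n p" and ?A = "{xs. (\<Sum>i<n. h (xs ! i)) > real n * (\<mu> + \<epsilon>)}"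
    have "measure ?R ?A = measure_pmf.expectation ?R (indicator ?A)" by simp
    also have "\<dots> \<le> measure_pmf.expectation ?R (\<lambda>xs. (sum_list (map g xs))\<^sup>2 / (real n * \<epsilon>)\<^sup>2)"
    proof (intro expectation_mono)
      fix xs assume "xs \<in> set_pmf ?R"
      then have "length xs = n" by (simp add: set_replicate_pmf)
      then have s: "sum_list (map g xs) = (\<Sum>i<n. h (xs ! i)) - real n * \<mu>"
        by (simp add: sum_list_sum_nth atLeast0LessThan g_def sum_subtractf)
      show "indicator ?A xs \<le> (sum_list (map g xs))\<^sup>2 / (real n * \<epsilon>)\<^sup>2"
      proof (cases "xs \<in> ?A")
        case True
        then have "real n * \<epsilon> \<le> sum_list (map g xs)" by (simp add: s algebra_simps)
        then have "(real n * \<epsilon>)\<^sup>2 \<le> (sum_list (map g xs))\<^sup>2"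
          using \<epsilon> by (intro power_mono) auto
        with True n \<epsilon> show ?thesis by simp
      qed simp
    qed (simp add: finite_set_replicate_pmf fin)
    also have "\<dots> = real n * V / (real n * \<epsilon>)\<^sup>2"
      by (simp add: replicate_pmf_second_moment[OF fin mean] V_def)
    also have "\<dots> = V / (real n * \<epsilon>\<^sup>2)"
      using n by (simp add: power2_eq_square)
    finally show ?thesis .
  qed
  have "(\<lambda>n. V / (real n * \<epsilon>\<^sup>2)) \<longlonglongrightarrow> 0"
    using \<epsilon> by real_asymp
  then have "\<forall>\<^sub>F n in sequentially. V / (real n * \<epsilon>\<^sup>2) < \<eta>"
    using \<eta> by (rule order_tendstoD)
  then show ?thesis
    using eventually_gt_at_top[of 0]
  proof eventually_elim
    case (elim n)
    with bound[of n] show ?case unfolding \<mu>_def by linarith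
  qed
qed

text \<open>Greedy choice of codewords: averaged over \<open>u\<close> drawn from the marginal \<open>r\<close>, the codeword
  \<open>u\<close> covers at least a fraction \<open>1 / B\<close> of what is still coverable.\<close>

lemma greedy_covering:
  fixes q :: "('a \<times> 'c) pmf"
  defines "p \<equiv> map_pmf fst q" and "r \<equiv> map_pmf snd q"
  assumes fin: "finite (set_pmf q)" and B: "B \<ge> 1"
    and T: "\<And>x u. (x, u) \<in> set_pmf q \<Longrightarrow> (x, u) \<in> T \<Longrightarrow> pmf q (x, u) \<le> B * (pmf p x * pmf r u)"
  shows "\<exists>cb. (\<forall>w. cb w \<in> set_pmf r) \<and>
    measure p {x. \<forall>w<M. (x, cb w) \<notin> T} \<le> measure q (- T) + (1 - 1 / B) ^ M"
proof (induction M)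
  case 0
  obtain u where "u \<in> set_pmf r" using set_pmf_not_empty[of r] by blast
  then show ?case by (intro exI[of _ "\<lambda>_. u"]) simp
next
  case (Suc M)
  then obtain cb where cb: "\<And>w. cb w \<in> set_pmf r"
    and IH: "measure p {x. \<forall>w<M. (x, cb w) \<notin> T} \<le> measure q (- T) + (1 - 1 / B) ^ M"
    by blast
  define A where "A = {x. \<forall>w<M. (x, cb w) \<notin> T}"
  define a where "a = (measure p A - measure q (- T)) / B"
  have finp: "finite (set_pmf p)" and finr: "finite (set_pmf r)"
    using fin by (simp_all add: p_def r_def)
  let ?t = "\<lambda>x u. if x \<in> A \<and> (x, u) \<in> T then 1 else 0 :: real"
  have cover: "measure p {x \<in> A. (x, u) \<in> T} = (\<Sum>x\<in>set_pmf p. pmf p x * ?t x u)" for u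
  proof -
    have "measure p {x \<in> A. (x, u) \<in> T} = measure_pmf.expectation p (indicator {x \<in> A. (x, u) \<in> T})"
      by simp
    also have "\<dots> = (\<Sum>x\<in>set_pmf p. pmf p x * indicator {x \<in> A. (x, u) \<in> T} x)"
      by (rule expectation_finite[OF finp])
    finally show ?thesis by (simp add: indicator_def of_bool_def)
  qed
  \<comment> \<open>An uncovered \<open>x\<close> drawn jointly with \<open>u\<close> either forms a
    pair outside \<open>T\<close> or would be covered by adding \<open>u\<close>. On
    \<open>T\<close> the joint law is at most \<open>B\<close> times the product law, which turns
    the second mass into an average over \<open>u\<close> drawn independently.\<close>
  have "measure p A = measure q (fst -` A)" by (simp add: p_def)
  also have "\<dots> \<le> measure q (- T \<union> {v \<in> T. fst v \<in> A})"
    by (intro measure_pmf.finite_measure_mono) auto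
  also have "\<dots> \<le> measure q (- T) + measure q {v \<in> T. fst v \<in> A}"
    by (rule measure_subadditive) auto
  also have "measure q {v \<in> T. fst v \<in> A} = measure_pmf.expectation q (indicator {v \<in> T. fst v \<in> A})"
    by simp
  also have "\<dots> = (\<Sum>v\<in>set_pmf q. pmf q v * ?t (fst v) (snd v))"
    unfolding expectation_finite[OF fin] by (intro sum.cong) (auto simp: indicator_def)
  also have "\<dots> \<le> (\<Sum>v\<in>set_pmf q. B * (pmf p (fst v) * pmf r (snd v)) * ?t (fst v) (snd v))"
    using T by (intro sum_mono) (auto simp del: mult.assoc)
  also have "\<dots> \<le> (\<Sum>v\<in>set_pmf p \<times> set_pmf r. B * (pmf p (fst v) * pmf r (snd v)) * ?t (fst v) (snd v))"
    using B finp finr by (intro sum_mono2) (auto simp: p_def r_def, force+)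
  also have "\<dots> = (\<Sum>u\<in>set_pmf r. \<Sum>x\<in>set_pmf p. B * (pmf p x * pmf r u) * ?t x u)"
    by (subst sum.swap) (simp add: sum.cartesian_product case_prod_unfold)
  also have "\<dots> = B * (\<Sum>u\<in>set_pmf r. pmf r u * measure p {x \<in> A. (x, u) \<in> T})"
    unfolding cover sum_distrib_left by (intro sum.cong refl) (simp add: mult_ac)
  finally have avg: "a \<le> (\<Sum>u\<in>set_pmf r. pmf r u * measure p {x \<in> A. (x, u) \<in> T})"
    using B by (simp add: a_def field_simps)
  have "\<exists>u\<in>set_pmf r. a \<le> measure p {x \<in> A. (x, u) \<in> T}"
  proof (rule ccontr)
    assume "\<not> ?thesis"
    then have less: "measure p {x \<in> A. (x, u) \<in> T} < a" if "u \<in> set_pmf r" for u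
      using that by force
    have "(\<Sum>u\<in>set_pmf r. pmf r u * measure p {x \<in> A. (x, u) \<in> T}) < (\<Sum>u\<in>set_pmf r. pmf r u * a)"
      using finr set_pmf_not_empty[of r] less
      by (intro sum_strict_mono mult_strict_left_mono) (auto intro: pmf_positive)
    also have "\<dots> = a"
      using finr by (simp add: sum_distrib_right[symmetric] sum_pmf_eq_1)
    finally show False using avg by simp
  qed
  then obtain u where u: "u \<in> set_pmf r" and gain: "a \<le> measure p {x \<in> A. (x, u) \<in> T}" by blast
  define cb' where "cb' = cb(M := u)"
  have "{x. \<forall>w<Suc M. (x, cb' w) \<notin> T} = A - {x \<in> A. (x, u) \<in> T}"
    by (auto simp: cb'_def A_def less_Suc_eq)
  then have "measure p {x. \<forall>w<Suc M. (x, cb' w) \<notin> T} = measure p A - measure p {x \<in> A. (x, u) \<in> T}"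
    by (simp add: measure_pmf.finite_measure_Diff)
  \<comment> \<open>The bound on the excess over the mass outside \<open>T\<close> shrinks by the
    factor \<open>1 - 1 / B\<close> in every round.\<close>
  also have "\<dots> \<le> measure q (- T) + (measure p A - measure q (- T)) * (1 - 1 / B)"
    using gain by (simp add: a_def algebra_simps diff_divide_distrib)
  also have "(measure p A - measure q (- T)) * (1 - 1 / B) \<le> (1 - 1 / B) ^ M * (1 - 1 / B)"
    using IH B by (intro mult_right_mono) (auto simp: A_def)
  finally show ?case
    using cb u by (intro exI[of _ cb']) (auto simp: cb'_def mult.commute)
qed

definition info_density :: "real \<Rightarrow> ('a \<times> 'c) pmf \<Rightarrow> 'a \<times> 'c \<Rightarrow> real" where
  "info_density b q v = log b (pmf q v / (pmf (map_pmf fst q) (fst v) * pmf (map_pmf snd q) (snd v)))"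

text \<open>For blocks, the ratio of the joint law to the product of its marginals is
  \<open>b\<close> raised to the sum of information densities, so the greedy bound applies with
  \<open>B = b powr L\<close>. Lists of pairs become pairs of lists, and \<open>zip\<close> leads
  back.\<close>

lemma covering_typical:
  fixes q :: "('a \<times> 'c) pmf"
  assumes b: "b > 1" and fin: "finite (set_pmf q)"
    and I: "\<And>ps. ps \<in> T \<Longrightarrow> (\<Sum>i<n. info_density b q (ps ! i)) \<le> L" and L: "L \<ge> 0"
  shows "\<exists>cb. (\<forall>w. length (cb w) = n \<and> set (cb w) \<subseteq> snd ` set_pmf q) \<and>
    measure (replicate_pmf n (map_pmf fst q)) {xs. \<forall>w<M. zip xs (cb w) \<notin> T}
      \<le> measure (replicate_pmf n q) (- T) + (1 - 1 / b powr L) ^ M"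
proof -
  let ?Q = "replicate_pmf n q"
  let ?f = "\<lambda>ps :: ('a \<times> 'c) list. (map fst ps, map snd ps)"
  define Q where "Q = map_pmf ?f ?Q"
  have inj: "inj ?f"
    by (intro inj_on_inverseI[where g = "\<lambda>(xs, us). zip xs us"]) (simp add: zip_map_fst_snd)
  have finQ: "finite (set_pmf Q)" by (simp add: Q_def fin finite_set_replicate_pmf)
  have Q1: "map_pmf fst Q = replicate_pmf n (map_pmf fst q)"
    and Q2: "map_pmf snd Q = replicate_pmf n (map_pmf snd q)"
    by (simp_all add: Q_def replicate_pmf_map pmf.map_comp o_def)
  have "\<exists>cb. (\<forall>w. cb w \<in> set_pmf (map_pmf snd Q)) \<and>
    measure (map_pmf fst Q) {x. \<forall>w<M. (x, cb w) \<notin> (\<lambda>(xs, us). zip xs us) -` T}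
      \<le> measure Q (- ((\<lambda>(xs, us). zip xs us) -` T)) + (1 - 1 / b powr L) ^ M"
  proof (rule greedy_covering[OF finQ])
    show "b powr L \<ge> 1" using b L by (simp add: ge_one_powr_ge_zero)
  next
    fix xs us assume "(xs, us) \<in> set_pmf Q" and T: "(xs, us) \<in> (\<lambda>(xs, us). zip xs us) -` T"
    then obtain ps where ps: "ps \<in> set_pmf ?Q" and xs: "xs = map fst ps" and us: "us = map snd ps"
      by (auto simp: Q_def)
    have len: "length ps = n" using ps by (simp add: set_replicate_pmf)
    have psT: "ps \<in> T" using T by (simp add: xs us zip_map_fst_snd)
    let ?p = "\<lambda>i. pmf (map_pmf fst q) (fst (ps ! i))" and ?r = "\<lambda>i. pmf (map_pmf snd q) (snd (ps ! i))"
    have pos: "ps ! i \<in> set_pmf q" if "i < n" for i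
      using ps that by (auto simp: set_replicate_pmf)
    have "pmf Q (xs, us) = pmf ?Q ps"
      using pmf_map_inj'[OF inj, of ?Q ps] by (simp add: Q_def xs us)
    also have "\<dots> = (\<Prod>i<n. b powr info_density b q (ps ! i) * (?p i * ?r i))"
      unfolding pmf_replicate_pmf[OF len]
    proof (intro prod.cong refl)
      fix i assume "i \<in> {..<n}"
      then have "ps ! i \<in> set_pmf q" using pos by simp
      then have "pmf q (ps ! i) > 0" "?p i > 0" "?r i > 0"
        by (auto intro!: pmf_positive)
      then show "pmf q (ps ! i) = b powr info_density b q (ps ! i) * (?p i * ?r i)"
        using b by (simp add: info_density_def)
    qed
    also have "\<dots> = b powr (\<Sum>i<n. info_density b q (ps ! i)) * ((\<Prod>i<n. ?p i) * (\<Prod>i<n. ?r i))"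
      using b by (simp add: prod.distrib powr_sum)
    also have "\<dots> \<le> b powr L * ((\<Prod>i<n. ?p i) * (\<Prod>i<n. ?r i))"
      using b I[OF psT] by (intro mult_right_mono powr_mono) (auto intro!: mult_nonneg_nonneg prod_nonneg)
    also have "(\<Prod>i<n. ?p i) * (\<Prod>i<n. ?r i) = pmf (map_pmf fst Q) xs * pmf (map_pmf snd Q) us"
      using len by (simp add: Q1 Q2 pmf_replicate_pmf xs us)
    finally show "pmf Q (xs, us) \<le> b powr L * (pmf (map_pmf fst Q) xs * pmf (map_pmf snd Q) us)" .
  qed
  moreover have "measure Q (- ((\<lambda>(xs, us). zip xs us) -` T)) = measure ?Q (- T)"
    by (simp add: Q_def vimage_def zip_map_fst_snd Compl_eq)
  ultimately obtain cb where cb: "\<And>w. cb w \<in> set_pmf (map_pmf snd Q)"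
    and m: "measure (replicate_pmf n (map_pmf fst q)) {xs. \<forall>w<M. zip xs (cb w) \<notin> T}
      \<le> measure ?Q (- T) + (1 - 1 / b powr L) ^ M"
    by (auto simp: Q1)
  have "length (cb w) = n \<and> set (cb w) \<subseteq> snd ` set_pmf q" for w
    using cb[of w] by (auto simp: Q2 set_replicate_pmf)
  with m show ?thesis by blast
qed

text \<open>The information density determines the codebook size and the functions in
  \<open>G\<close> the averages; one typical set handles both, and blocks without typical codeword
  are charged the worst case.\<close>

lemma covering:
  fixes q :: "('a::finite \<times> nat) pmf" and G :: "('a \<times> nat \<Rightarrow> real) set"
  assumes b: "b > 1" and fin: "finite (set_pmf q)" and finG: "finite G"
    and R: "R \<ge> 0" "measure_pmf.expectation q (info_density b q) \<le> R" and \<epsilon>: "\<epsilon> > 0"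
  shows "\<forall>\<^sub>F n in sequentially. \<exists>M cb f. 0 < M \<and> log b (real M) \<le> real n * (R + \<epsilon>) \<and>
    (\<forall>xs. f xs < M) \<and>
    (\<forall>g\<in>G. (\<Sum>i<n. measure_pmf.expectation (replicate_pmf n (map_pmf fst q))
        (\<lambda>xs. g (xs ! i, cb (f xs) ! i))) \<le> real n * (measure_pmf.expectation q g + \<epsilon>))"
proof -
  define p where "p = map_pmf fst q"
  define U where "U = snd ` set_pmf q"
  define H where "H = insert (info_density b q) G"
  define T where "T = (\<lambda>n. {ps. \<forall>h\<in>H. (\<Sum>i<n. h (ps ! i))
      \<le> real n * (measure_pmf.expectation q h + \<epsilon> / 2)})"
  have finH: "finite H" and cardH: "card H > 0" by (simp_all add: H_def finG card_gt_0_iff)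
  \<comment> \<open>The bound must hold for all pairs of a source letter and a codeword letter, not
    only on the support of \<open>q\<close>, since an uncovered block may meet any codeword.\<close>
  have "finite ((\<lambda>(g, v). \<bar>g v\<bar>) ` (G \<times> (UNIV \<times> U)))"
    using finG fin by (simp add: U_def)
  then obtain B0 where B0: "\<And>g x u. g \<in> G \<Longrightarrow> u \<in> U \<Longrightarrow> \<bar>g (x, u)\<bar> \<le> B0"
    using bdd_above_finite unfolding bdd_above_def by fastforce
  define B where "B = max B0 1"
  have B: "\<bar>g (x, u)\<bar> \<le> B" if "g \<in> G" "u \<in> U" for g x u
    using B0[OF that, of x] by (simp add: B_def)
  have B1: "B \<ge> 1" by (simp add: B_def)
  \<comment> \<open>Atypical blocks and the greedy remainder have mass at most \<open>\<eta>\<close>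
    each. An uncovered block costs at most \<open>2 * B\<close> extra per letter, so together they
    add \<open>\<epsilon> / 2\<close>; the other half is the slack in \<open>T\<close>.\<close>
  define \<eta> where "\<eta> = \<epsilon> / (8 * B)"
  have \<eta>: "\<eta> > 0" using \<epsilon> B1 by (simp add: \<eta>_def)
  have "\<forall>\<^sub>F n in sequentially. \<forall>h\<in>H. measure (replicate_pmf n q)
      {ps. (\<Sum>i<n. h (ps ! i)) > real n * (measure_pmf.expectation q h + \<epsilon> / 2)} \<le> \<eta> / card H"
    using finH fin \<epsilon> \<eta> cardH by (intro eventually_ball_finite ballI weak_law_upper) auto
  then have atypical: "\<forall>\<^sub>F n in sequentially. measure (replicate_pmf n q) (- T n) \<le> \<eta>"
  proof eventually_elim
    case (elim n)
    have "- T n = (\<Union>h\<in>H. {ps. (\<Sum>i<n. h (ps ! i)) > real n * (measure_pmf.expectation q h + \<epsilon> / 2)})"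
      by (auto simp: T_def not_le)
    then have "measure (replicate_pmf n q) (- T n) \<le> (\<Sum>h\<in>H. measure (replicate_pmf n q)
      {ps. (\<Sum>i<n. h (ps ! i)) > real n * (measure_pmf.expectation q h + \<epsilon> / 2)})"
      using finH by (simp add: measure_pmf.finite_measure_subadditive_finite)
    also have "\<dots> \<le> (\<Sum>h\<in>H. \<eta> / card H)" using elim by (intro sum_mono) auto
    also have "\<dots> = \<eta>" using cardH by simp
    finally show ?case .
  qed
  define L where "L = (\<lambda>n. real n * (R + \<epsilon> / 2))"
  define M where "M = (\<lambda>n. nat \<lfloor>b powr (real n * (R + \<epsilon>))\<rfloor>)"
  have Mpos: "M n > 0" and Mle: "real (M n) \<le> b powr (real n * (R + \<epsilon>))"
    and Mge: "real (M n) \<ge> b powr (real n * (R + \<epsilon>)) - 1" for n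
  proof -
    have "1 \<le> b powr (real n * (R + \<epsilon>))"
      using b R \<epsilon> by (intro ge_one_powr_ge_zero) auto
    then have "1 \<le> \<lfloor>b powr (real n * (R + \<epsilon>))\<rfloor>" by (simp add: le_floor_iff)
    moreover from this have "real (M n) = of_int \<lfloor>b powr (real n * (R + \<epsilon>))\<rfloor>"
      by (simp add: M_def)
    ultimately show "M n > 0" "real (M n) \<le> b powr (real n * (R + \<epsilon>))"
      "real (M n) \<ge> b powr (real n * (R + \<epsilon>)) - 1"
      by (simp_all add: M_def)
  qed
  define \<kappa> where "\<kappa> = \<epsilon> / 2 * ln b"
  have \<kappa>: "\<kappa> > 0" using b \<epsilon> by (simp add: \<kappa>_def)
  \<comment> \<open>As 1 - t is at most exp (- t), it suffices that the ratio of \<open>M n\<close>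
    to \<open>b powr L n\<close> is at least \<open>real n * \<kappa>\<close>. That ratio is about
    \<open>exp (real n * \<kappa>)\<close>, which leaves room for the rounding in
    \<open>M\<close>.\<close>
  have miss: "(1 - 1 / b powr L n) ^ M n \<le> exp (- (real n * \<kappa>))" for n
  proof -
    have L1: "b powr L n \<ge> 1" using b R \<epsilon> by (auto simp: L_def intro!: ge_one_powr_ge_zero)
    have "real n * \<kappa> \<le> exp (real n * \<kappa>) - 1" using exp_ge_add_one_self[of "real n * \<kappa>"] by linarith
    also have "exp (real n * \<kappa>) = b powr (real n * (R + \<epsilon>)) / b powr L n"
    proof -
      have "real n * (R + \<epsilon>) - L n = real n * (\<epsilon> / 2)" by (simp add: L_def algebra_simps)
      then show ?thesis
        unfolding powr_diff[symmetric] using b by (simp add: powr_def \<kappa>_def mult.assoc)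
    qed
    also have "\<dots> - 1 \<le> b powr (real n * (R + \<epsilon>)) / b powr L n - 1 / b powr L n"
      using L1 by (simp add: divide_le_eq_1)
    also have "\<dots> \<le> real (M n) / b powr L n"
      using Mge[of n] L1 by (simp add: diff_divide_distrib[symmetric] divide_right_mono)
    finally have *: "real n * \<kappa> \<le> real (M n) / b powr L n" .
    have "(1 - 1 / b powr L n) ^ M n \<le> exp (- (1 / b powr L n)) ^ M n"
      using L1 exp_ge_add_one_self[of "- (1 / b powr L n)"] by (intro power_mono) (auto simp: divide_le_eq_1)
    also have "\<dots> = exp (- (real (M n) / b powr L n))"
      by (simp add: exp_of_nat_mult[symmetric])
    also have "\<dots> \<le> exp (- (real n * \<kappa>))" using * by simp
    finally show ?thesis .
  qed
  have "(\<lambda>n. exp (- (real n * \<kappa>))) \<longlonglongrightarrow> 0" using \<kappa> by real_asymp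
  from order_tendstoD(2)[OF this \<eta>] atypical show ?thesis
  proof eventually_elim
    case (elim n)
    have "(\<Sum>i<n. info_density b q (ps ! i)) \<le> L n" if "ps \<in> T n" for ps
    proof -
      have "(\<Sum>i<n. info_density b q (ps ! i))
          \<le> real n * (measure_pmf.expectation q (info_density b q) + \<epsilon> / 2)"
        using that by (simp add: T_def H_def)
      also have "\<dots> \<le> L n" using R by (auto simp: L_def intro!: mult_left_mono)
      finally show ?thesis .
    qed
    moreover have "L n \<ge> 0" using R \<epsilon> by (simp add: L_def)
    ultimately obtain cb where cb: "\<And>w. length (cb w) = n" "\<And>w. set (cb w) \<subseteq> U"
      and "measure (replicate_pmf n p) {xs. \<forall>w<M n. zip xs (cb w) \<notin> T n}
        \<le> measure (replicate_pmf n q) (- T n) + (1 - 1 / b powr L n) ^ M n"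
      using covering_typical[OF b fin, of "T n" n "L n" "M n"] unfolding p_def U_def by blast
    with miss[of n] elim
    have fail: "measure (replicate_pmf n p) {xs. \<forall>w<M n. zip xs (cb w) \<notin> T n} \<le> \<epsilon> / (4 * B)"
      (is "measure _ ?F \<le> _")
      by (simp add: \<eta>_def field_simps)
    \<comment> \<open>Message 0 is an arbitrary default for uncovered blocks; it is valid because
      \<open>M n\<close> is positive.\<close>
    define f where "f = (\<lambda>xs. if xs \<in> ?F then 0 else LEAST w. w < M n \<and> zip xs (cb w) \<in> T n)"
    have f: "f xs < M n \<and> zip xs (cb (f xs)) \<in> T n" if "xs \<notin> ?F" for xs
      using that LeastI_ex[of "\<lambda>w. w < M n \<and> zip xs (cb w) \<in> T n"] by (auto simp: f_def)
    have fM: "f xs < M n" for xs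
      using f[of xs] Mpos[of n] by (cases "xs \<in> ?F") (auto simp: f_def)
    have finR: "finite (set_pmf (replicate_pmf n p))"
      by (simp add: finite_set_replicate_pmf p_def fin)
    have avg: "(\<Sum>i<n. measure_pmf.expectation (replicate_pmf n p) (\<lambda>xs. g (xs ! i, cb (f xs) ! i)))
        \<le> real n * (measure_pmf.expectation q g + \<epsilon>)" if g: "g \<in> G" for g
    proof -
      let ?\<mu> = "measure_pmf.expectation q g"
      have "measure_pmf.expectation q (\<lambda>_. - B) \<le> ?\<mu>"
      proof (intro expectation_mono fin)
        fix v assume "v \<in> set_pmf q"
        then show "- B \<le> g v" using B[OF g, of "snd v" "fst v"] by (simp add: U_def abs_le_iff)
      qed
      then have \<mu>: "- B \<le> ?\<mu>" by simp
      have "(\<Sum>i<n. measure_pmf.expectation (replicate_pmf n p) (\<lambda>xs. g (xs ! i, cb (f xs) ! i)))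
          = measure_pmf.expectation (replicate_pmf n p) (\<lambda>xs. \<Sum>i<n. g (xs ! i, cb (f xs) ! i))"
        by (rule expectation_sum[OF finR, symmetric])
      also have "\<dots> \<le> measure_pmf.expectation (replicate_pmf n p)
          (\<lambda>xs. real n * (?\<mu> + \<epsilon> / 2) + real n * (2 * B) * indicator ?F xs)"
      proof (intro expectation_mono finR)
        fix xs assume "xs \<in> set_pmf (replicate_pmf n p)"
        then have len: "length xs = n" by (simp add: set_replicate_pmf)
        show "(\<Sum>i<n. g (xs ! i, cb (f xs) ! i))
            \<le> real n * (?\<mu> + \<epsilon> / 2) + real n * (2 * B) * indicator ?F xs"
        proof (cases "xs \<in> ?F")
          case True
          have "(\<Sum>i<n. g (xs ! i, cb (f xs) ! i)) \<le> (\<Sum>i<n. B)"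
          proof (intro sum_mono)
            fix i assume "i \<in> {..<n}"
            then have "cb (f xs) ! i \<in> U" using cb[of "f xs"] by auto
            from B[OF g this, of "xs ! i"] show "g (xs ! i, cb (f xs) ! i) \<le> B" by simp
          qed
          also have "\<dots> = real n * B" by simp
          \<comment> \<open>The mean is at least \<open>- B\<close>, so adding \<open>2 * B\<close>
            to it dominates the worst value \<open>B\<close>.\<close>
          also have "\<dots> \<le> real n * ((?\<mu> + \<epsilon> / 2) + 2 * B)"
            using \<mu> \<epsilon> B1 by (intro mult_left_mono) auto
          finally show ?thesis using True by (simp add: algebra_simps)
        next
          case False
          have "(\<Sum>i<n. g (xs ! i, cb (f xs) ! i)) = (\<Sum>i<n. g (zip xs (cb (f xs)) ! i))"
            using len cb(1) by (intro sum.cong) auto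
          also have "\<dots> \<le> real n * (?\<mu> + \<epsilon> / 2)"
            using f[OF False] g by (auto simp: T_def H_def)
          finally show ?thesis using False by simp
        qed
      qed
      also have "\<dots> = real n * (?\<mu> + \<epsilon> / 2) + real n * (2 * B) * measure (replicate_pmf n p) ?F"
        by (subst expectation_add[OF finR]) simp
      also have "\<dots> \<le> real n * (?\<mu> + \<epsilon> / 2) + real n * (2 * B) * (\<epsilon> / (4 * B))"
        using fail B1 by (intro add_left_mono mult_left_mono) auto
      also have "\<dots> = real n * (?\<mu> + \<epsilon>)" using B1 by (simp add: field_simps)
      finally show ?thesis .
    qed
    have "log b (real (M n)) \<le> real n * (R + \<epsilon>)"
      using Mle[of n] Mpos[of n] b by (simp add: log_le_iff)
    with Mpos[of n] fM avg show ?case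
      by (intro exI[of _ "M n"] exI[of _ cb] exI[of _ f]) (auto simp: p_def)
  qed
qed

section \<open>Costs averaged given the source letter and the codeword letter\<close>

lemma single_letter_joint_joint_pmf:
  "single_letter_joint (joint_pmf p C) PU PR
    = bind_pmf (joint_pmf p PU) (\<lambda>(x, u). bind_pmf (C x) (\<lambda>(y, z). map_pmf (\<lambda>r. (x, y, z, u, r)) (PR u y)))"
proof -
  have "single_letter_joint (joint_pmf p C) PU PR
    = do {x \<leftarrow> p; v \<leftarrow> C x; u \<leftarrow> PU x; map_pmf (\<lambda>r. (x, fst v, snd v, u, r)) (PR u (fst v))}"
    by (simp add: single_letter_joint_def joint_pmf_def bind_assoc_pmf bind_map_pmf case_prod_unfold
        map_pmf_def[of _ "PR _ _"])
  also have "\<dots> = do {x \<leftarrow> p; u \<leftarrow> PU x; v \<leftarrow> C x; map_pmf (\<lambda>r. (x, fst v, snd v, u, r)) (PR u (fst v))}"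
    by (intro bind_pmf_cong refl) (rule bind_commute_pmf)
  finally show ?thesis
    by (simp add: joint_pmf_def bind_assoc_pmf bind_map_pmf case_prod_unfold)
qed

text \<open>The encoder selects codewords by looking at (x, u) only, so a cost that also involves
  (y, z, r) enters the covering through its conditional mean.\<close>

definition cond_mean ::
  "('x \<Rightarrow> ('y \<times> 'z) pmf) \<Rightarrow> (nat \<Rightarrow> 'y \<Rightarrow> 'r pmf) \<Rightarrow> ('x \<times> 'y \<times> 'z \<times> nat \<times> 'r \<Rightarrow> real)
    \<Rightarrow> 'x \<times> nat \<Rightarrow> real"
  where
  "cond_mean C PR \<phi> = (\<lambda>(x, u). measure_pmf.expectation (C x)
     (\<lambda>(y, z). measure_pmf.expectation (PR u y) (\<lambda>r. \<phi> (x, y, z, u, r))))"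

lemma expectation_single_letter_joint:
  fixes C :: "'x::finite \<Rightarrow> ('y::finite \<times> 'z::finite) pmf" and PR :: "nat \<Rightarrow> 'y \<Rightarrow> 'r::finite pmf"
  assumes C: "P = joint_pmf p C" and fin: "\<And>x. finite (set_pmf (PU x))"
  shows "measure_pmf.expectation (single_letter_joint P PU PR) \<phi>
    = measure_pmf.expectation (joint_pmf p PU) (cond_mean C PR \<phi>)"
proof -
  have "finite (set_pmf (joint_pmf p PU))" using fin by (simp add: joint_pmf_def)
  then show ?thesis
    unfolding C single_letter_joint_joint_pmf cond_mean_def
    by (simp add: expectation_bind_finite case_prod_unfold expectation_map_pmf)
qed

definition codebook_code ::
  "nat \<Rightarrow> ('x list \<Rightarrow> nat) \<Rightarrow> (nat \<Rightarrow> nat list) \<Rightarrow> (nat \<Rightarrow> 'y \<Rightarrow> 'r pmf) \<Rightarrow> ('x, 'y, 'r) code" where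
  "codebook_code M f cb PR = \<lparr>msgs = {..<M}, enc = f, dec = \<lambda>i w y. PR (cb w ! i) y\<rparr>"

text \<open>Given the source block, the triple (y, z, r) at position \<open>i\<close> depends only
  on the source letter and the codeword letter there, so the averaged cost has exactly the
  expectation of the original one.\<close>

lemma expectation_codebook_code:
  fixes P :: "('x::finite \<times> 'y::finite \<times> 'z::finite) pmf" and PR :: "nat \<Rightarrow> 'y \<Rightarrow> 'r::finite pmf"
  assumes C: "P = joint_pmf (map_pmf fst P) C"
  shows "measure_pmf.expectation (code_joint P n (codebook_code M f cb PR))
      (\<lambda>(xs, ys, zs, w, rs). \<Sum>i<n. \<phi> (xs ! i, ys ! i, zs ! i, cb w ! i, rs ! i))
    = (\<Sum>i<n. measure_pmf.expectation (replicate_pmf n (map_pmf fst P))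
        (\<lambda>xs. cond_mean C PR \<phi> (xs ! i, cb (f xs) ! i)))"
proof -
  let ?p = "map_pmf fst P"
  have "measure_pmf.expectation (single_letter_joint P (message_kernel ?p n f i) (\<lambda>w y. PR (cb w ! i) y))
        (\<lambda>(x, y, z, w, r). \<phi> (x, y, z, cb w ! i, r))
      = measure_pmf.expectation (replicate_pmf n ?p) (\<lambda>xs. cond_mean C PR \<phi> (xs ! i, cb (f xs) ! i))"
    if i: "i < n" for i
  proof -
    have "measure_pmf.expectation (single_letter_joint P (message_kernel ?p n f i) (\<lambda>w y. PR (cb w ! i) y))
        (\<lambda>(x, y, z, w, r). \<phi> (x, y, z, cb w ! i, r))
      = measure_pmf.expectation (joint_pmf ?p (message_kernel ?p n f i))
          (\<lambda>(x, w). cond_mean C PR \<phi> (x, cb w ! i))"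
      by (simp add: expectation_single_letter_joint[OF C finite_message_kernel] cond_mean_def)
    also have "\<dots> = measure_pmf.expectation (replicate_pmf n ?p)
        (\<lambda>xs. cond_mean C PR \<phi> (xs ! i, cb (f xs) ! i))"
      by (simp add: replicate_marginal[OF i, symmetric] expectation_map_pmf)
    finally show ?thesis .
  qed
  then show ?thesis
    using expectation_code_joint_sum[of P n "codebook_code M f cb PR"
        "\<lambda>i (x, y, z, w, r). \<phi> (x, y, z, cb w ! i, r)"]
    by (simp add: codebook_code_def)
qed

section \<open>Achievability\<close>

text \<open>If \<open>q1\<close> is the law of Z given U and \<open>q2\<close> that of (X, Y) given
  (U, R, Z), its mean under the single-letter law is H(R|U,Z) + I(X;U).\<close>

definition equiv_density ::
  "real \<Rightarrow> ('x \<times> 'y \<times> 'z) pmf \<Rightarrow> (nat \<Rightarrow> 'y \<Rightarrow> 'r pmf) \<Rightarrow> (nat \<Rightarrow> 'z pmf)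
    \<Rightarrow> (nat \<times> 'r \<times> 'z \<Rightarrow> ('x \<times> 'y) pmf) \<Rightarrow> 'x \<times> 'y \<times> 'z \<times> nat \<times> 'r \<Rightarrow> real"
  where
  "equiv_density b P PR q1 q2 = (\<lambda>(x, y, z, u, r).
     log b (pmf (q1 u) z) + log b (pmf (q2 (u, r, z)) (x, y))
       - log b (pmf P (x, y, z) * pmf (PR u y) r))"

text \<open>Writes \<open>H(R\<^sup>n | W, Z\<^sup>n)\<close> as \<open>H(X\<^sup>n, Y\<^sup>n, Z\<^sup>n, R\<^sup>n) - H(X\<^sup>n, Y\<^sup>n | R\<^sup>n, W, Z\<^sup>n) - H(W, Z\<^sup>n)\<close>:
  the first entropy is explicit, and Gibbs' inequality bounds the other two from above by cross
  entropies, which are additive over the positions.\<close>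

lemma codebook_equivocation_ge:
  fixes P :: "('x::finite \<times> 'y::finite \<times> 'z::finite) pmf" and PR :: "nat \<Rightarrow> 'y \<Rightarrow> 'r::finite pmf"
  assumes b: "b > 1" and M: "M > 0" and f: "\<And>xs. f xs < M"
    and q1: "\<And>u z. pmf (q1 u) z > 0" and q2: "\<And>v xy. pmf (q2 v) xy > 0"
  shows "measure_pmf.expectation (code_joint P n (codebook_code M f cb PR))
      (\<lambda>(xs, ys, zs, w, rs). \<Sum>i<n. equiv_density b P PR q1 q2 (xs ! i, ys ! i, zs ! i, cb w ! i, rs ! i))
      - log b (real M)
    \<le> cond_entropy_pmf b (code_joint P n (codebook_code M f cb PR))
        (\<lambda>(xs, ys, zs, w, rs). rs) (\<lambda>(xs, ys, zs, w, rs). (w, zs))"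
proof -
  let ?c = "codebook_code M f cb PR"
  define J where "J = code_joint P n ?c"
  let ?RS = "\<lambda>(xs :: 'x list, ys :: 'y list, zs :: 'z list, w :: nat, rs :: 'r list). rs"
  let ?WZ = "\<lambda>(xs :: 'x list, ys :: 'y list, zs :: 'z list, w :: nat, rs :: 'r list). (w, zs)"
  let ?XY = "\<lambda>(xs :: 'x list, ys :: 'y list, zs :: 'z list, w :: nat, rs :: 'r list). zip xs ys"
  have fin: "finite (set_pmf J)" by (simp add: J_def finite_code_joint)
  define pW where "pW = (\<lambda>s. pmf (map_pmf ?WZ J) (?WZ s))"
  define pRW where "pRW = (\<lambda>s. pmf (map_pmf (\<lambda>s. (?RS s, ?WZ s)) J) (?RS s, ?WZ s))"
  \<comment> \<open>The guess for (W, Z^n): a uniform message, then independent letters along its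
    codeword. The uniform factor is the source of the loss \<open>log b (real M)\<close>.\<close>
  define kW where "kW = joint_pmf (pmf_of_set {..<M}) (\<lambda>w. product_list_pmf n (\<lambda>i. q1 (cb w ! i)))"
  define kXY where "kXY = (\<lambda>(rs :: 'r list, w, zs). product_list_pmf n (\<lambda>i. q2 (cb w ! i, rs ! i, zs ! i)))"
  have lists: "\<exists>xs ys zs rs. s = (xs, ys, zs, f xs, rs) \<and> length xs = n \<and> length ys = n \<and>
      length zs = n \<and> length rs = n" if "s \<in> set_pmf J" for s
    using that unfolding J_def by (elim set_code_joint) (auto simp: codebook_code_def)
  have pW: "pW s > 0" and pRW: "pRW s > 0" if "s \<in> set_pmf J" for s
    using that by (auto simp: pW_def pRW_def intro!: pmf_positive)
  have kW: "pmf kW (f xs, zs) = 1 / real M * (\<Prod>i<n. pmf (q1 (cb (f xs) ! i)) (zs ! i))"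
    if "length zs = n" for xs zs
  proof -
    have "pmf (pmf_of_set {..<M}) (f xs) = 1 / real M" using M f[of xs] by (subst pmf_of_set) auto
    with that show ?thesis by (simp add: kW_def pmf_joint_pmf pmf_product_list_pmf)
  qed
  have kXY: "pmf (kXY (rs, w, zs)) (zip xs ys) = (\<Prod>i<n. pmf (q2 (cb w ! i, rs ! i, zs ! i)) (xs ! i, ys ! i))"
    if "length xs = n" "length ys = n" for xs ys zs w and rs :: "'r list"
    using that by (simp add: kXY_def pmf_product_list_pmf)
  have kWpos: "pmf kW (?WZ s) > 0" and kXYpos: "pmf (kXY (?RS s, ?WZ s)) (?XY s) > 0"
    if "s \<in> set_pmf J" for s
    using lists[OF that] M q1 q2 by (auto simp: kW kXY intro!: prod_pos mult_pos_pos divide_pos_pos)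
  have W: "measure_pmf.expectation J (\<lambda>s. log b (pmf kW (?WZ s))) \<le> measure_pmf.expectation J (\<lambda>s. log b (pW s))"
  proof -
    have "map_pmf (\<lambda>_. ()) J = return_pmf ()" by (simp add: map_pmf_const)
    moreover have "pmf (map_pmf (\<lambda>s. (?WZ s, ())) J) (v, ()) = pmf (map_pmf ?WZ J) v" for v
      using pmf_map_inj'[of "\<lambda>v. (v, ())" "map_pmf ?WZ J" v] by (simp add: inj_def pmf.map_comp o_def)
    ultimately show ?thesis
      using gibbs_conditional[OF b fin, of "\<lambda>_. kW" "\<lambda>_. ()" ?WZ] kWpos
      by (simp add: pW_def)
  qed
  have full: "pmf (map_pmf (\<lambda>s. (?XY s, ?RS s, ?WZ s)) J) (?XY s, ?RS s, ?WZ s) = pmf J s"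
    if "s \<in> set_pmf J" for s
  proof -
    \<comment> \<open>This holds on the support only: there the message is \<open>f xs\<close>, and
      equal lengths allow \<open>zip\<close> to be undone.\<close>
    have "inj_on (\<lambda>s. (?XY s, ?RS s, ?WZ s)) (set_pmf J)"
    proof (rule inj_onI)
      fix s t assume s: "s \<in> set_pmf J" and t: "t \<in> set_pmf J"
        and eq: "(?XY s, ?RS s, ?WZ s) = (?XY t, ?RS t, ?WZ t)"
      obtain xs ys zs rs where sv: "s = (xs, ys, zs, f xs, rs)" "length xs = n" "length ys = n"
        using lists[OF s] by blast
      obtain xs' ys' zs' rs' where tv: "t = (xs', ys', zs', f xs', rs')" "length xs' = n" "length ys' = n"
        using lists[OF t] by blast
      have zip: "zip xs ys = zip xs' ys'" and rest: "rs = rs'" "zs = zs'" using eq by (simp_all add: sv(1) tv(1))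
      have "xs = xs'" using arg_cong[OF zip, of "map fst"] sv(2,3) tv(2,3) by simp
      moreover have "ys = ys'" using arg_cong[OF zip, of "map snd"] sv(2,3) tv(2,3) by simp
      ultimately show "s = t" by (simp add: sv(1) tv(1) rest)
    qed
    from pmf_map_inj[OF this that] show ?thesis .
  qed
  have XY: "measure_pmf.expectation J (\<lambda>s. log b (pmf (kXY (?RS s, ?WZ s)) (?XY s)))
      \<le> measure_pmf.expectation J (\<lambda>s. log b (pmf J s / pRW s))"
  proof -
    have "measure_pmf.expectation J (\<lambda>s. log b (pmf (kXY (?RS s, ?WZ s)) (?XY s)))
      \<le> measure_pmf.expectation J (\<lambda>s. log b (pmf (map_pmf (\<lambda>s. (?XY s, ?RS s, ?WZ s)) J)
          (?XY s, ?RS s, ?WZ s) / pmf (map_pmf (\<lambda>s. (?RS s, ?WZ s)) J) (?RS s, ?WZ s)))"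
      by (rule gibbs_conditional[OF b fin, of kXY "\<lambda>s. (?RS s, ?WZ s)" ?XY]) (rule kXYpos)
    also have "\<dots> = measure_pmf.expectation J (\<lambda>s. log b (pmf J s / pRW s))"
      by (intro expectation_cong) (simp only: full pRW_def)
    finally show ?thesis .
  qed
  have "measure_pmf.expectation J (\<lambda>(xs, ys, zs, w, rs).
        \<Sum>i<n. equiv_density b P PR q1 q2 (xs ! i, ys ! i, zs ! i, cb w ! i, rs ! i)) - log b (real M)
      = measure_pmf.expectation J (\<lambda>s. (\<lambda>(xs, ys, zs, w, rs).
        \<Sum>i<n. equiv_density b P PR q1 q2 (xs ! i, ys ! i, zs ! i, cb w ! i, rs ! i)) s - log b (real M))"
    by (simp add: expectation_diff[OF fin])
  also have "\<dots> = measure_pmf.expectation J (\<lambda>s. log b (pmf kW (?WZ s))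
      + log b (pmf (kXY (?RS s, ?WZ s)) (?XY s)) - log b (pmf J s))"
  proof (intro expectation_cong)
    fix s assume s: "s \<in> set_pmf J"
    from lists[OF s] obtain xs ys zs rs where sv: "s = (xs, ys, zs, f xs, rs)"
      and len: "length xs = n" "length ys = n" "length zs = n" "length rs = n" by blast
    let ?j = "\<lambda>i. pmf P (xs ! i, ys ! i, zs ! i) * pmf (PR (cb (f xs) ! i) (ys ! i)) (rs ! i)"
    have J: "pmf J s = (\<Prod>i<n. ?j i)"
      using pmf_code_joint[OF len, of P ?c] by (simp add: J_def sv codebook_code_def)
    have "?j i \<noteq> 0" if "i < n" for i
    proof
      assume "?j i = 0"
      with that have "(\<Prod>i<n. ?j i) = 0" by (intro prod_zero) auto
      with pmf_positive[OF s] show False unfolding J by simp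
    qed
    then have jpos: "?j i > 0" if "i < n" for i
      using that by (metis less_eq_real_def mult_nonneg_nonneg pmf_nonneg)
    have 1: "log b (pmf J s) = (\<Sum>i<n. log b (?j i))"
      unfolding J by (intro log_prod_positive) (use jpos in auto)
    have 2: "log b (pmf (kXY (?RS s, ?WZ s)) (?XY s))
        = (\<Sum>i<n. log b (pmf (q2 (cb (f xs) ! i, rs ! i, zs ! i)) (xs ! i, ys ! i)))"
      by (simp add: sv kXY len) (intro log_prod_positive q2 finite_lessThan)
    have "(\<Prod>i<n. pmf (q1 (cb (f xs) ! i)) (zs ! i)) > 0" by (intro prod_pos) (simp add: q1)
    then have "log b (pmf kW (?WZ s)) = - log b (real M) + log b (\<Prod>i<n. pmf (q1 (cb (f xs) ! i)) (zs ! i))"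
      using M b by (simp add: sv kW len log_divide del: prod_zero_iff)
    also have "log b (\<Prod>i<n. pmf (q1 (cb (f xs) ! i)) (zs ! i))
        = (\<Sum>i<n. log b (pmf (q1 (cb (f xs) ! i)) (zs ! i)))"
      by (intro log_prod_positive q1 finite_lessThan)
    finally have 3: "log b (pmf kW (?WZ s))
        = - log b (real M) + (\<Sum>i<n. log b (pmf (q1 (cb (f xs) ! i)) (zs ! i)))" .
    show "(\<lambda>(xs, ys, zs, w, rs).
        \<Sum>i<n. equiv_density b P PR q1 q2 (xs ! i, ys ! i, zs ! i, cb w ! i, rs ! i)) s - log b (real M)
      = log b (pmf kW (?WZ s)) + log b (pmf (kXY (?RS s, ?WZ s)) (?XY s)) - log b (pmf J s)"
      unfolding 1 2 3 by (simp add: sv equiv_density_def sum.distrib sum_subtractf)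
  qed
  also have "\<dots> = measure_pmf.expectation J (\<lambda>s. log b (pmf kW (?WZ s)))
      + measure_pmf.expectation J (\<lambda>s. log b (pmf (kXY (?RS s, ?WZ s)) (?XY s)))
      - measure_pmf.expectation J (\<lambda>s. log b (pmf J s))"
    by (simp only: expectation_diff[OF fin] expectation_add[OF fin])
  also have "\<dots> \<le> measure_pmf.expectation J (\<lambda>s. log b (pW s))
      + measure_pmf.expectation J (\<lambda>s. log b (pmf J s / pRW s))
      - measure_pmf.expectation J (\<lambda>s. log b (pmf J s))"
    using W XY by linarith
  also have "\<dots> = measure_pmf.expectation J (\<lambda>s. log b (pW s) + log b (pmf J s / pRW s) - log b (pmf J s))"
    by (simp only: expectation_diff[OF fin] expectation_add[OF fin])
  also have "\<dots> = measure_pmf.expectation J (\<lambda>s. - log b (pRW s / pW s))"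
  proof (intro expectation_cong)
    fix s assume "s \<in> set_pmf J"
    from pW[OF this] pRW[OF this] pmf_positive[OF this] b
    show "log b (pW s) + log b (pmf J s / pRW s) - log b (pmf J s) = - log b (pRW s / pW s)"
      by (simp add: log_divide)
  qed
  also have "\<dots> = cond_entropy_pmf b J ?RS ?WZ"
    by (simp add: cond_entropy_pmf_eq[OF b] pW_def pRW_def)
  finally show ?thesis by (simp add: J_def)
qed

text \<open>A small admixture of the uniform law keeps logarithms under control at letters of
  probability zero, while lowering no log probability on the support of \<open>p\<close> by more
  than - log (1 - s).\<close>

definition smooth_pmf :: "real \<Rightarrow> 'a::finite pmf \<Rightarrow> 'a pmf" where
  "smooth_pmf s p = bind_pmf (bernoulli_pmf s) (\<lambda>t. if t then pmf_of_set UNIV else p)"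

lemma pmf_smooth_pmf:
  assumes "0 < s" "s < 1"
  shows "pmf (smooth_pmf s p) x = s / real CARD('a) + (1 - s) * pmf (p :: 'a::finite pmf) x"
  using assms by (simp add: smooth_pmf_def pmf_bind expectation_UNIV UNIV_bool)

lemma pmf_smooth_pmf_pos:
  assumes "0 < s" "s < 1"
  shows "pmf (smooth_pmf s p) x > 0"
  using assms by (simp add: pmf_smooth_pmf add_pos_nonneg)

lemma log_pmf_smooth_pmf_ge:
  assumes "0 < s" "s < 1" "b > 1" "pmf p x > 0"
  shows "log b (pmf (smooth_pmf s p) x) \<ge> log b (1 - s) + log b (pmf p x)"
proof -
  have "log b (1 - s) + log b (pmf p x) = log b ((1 - s) * pmf p x)"
    using assms by (simp add: log_mult)
  also have "\<dots> \<le> log b (pmf (smooth_pmf s p) x)"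
    using assms pmf_smooth_pmf_pos[OF assms(1,2), of p x]
    by (subst log_le_cancel_iff) (simp_all add: pmf_smooth_pmf)
  finally show ?thesis .
qed

text \<open>With the exact conditional laws the density splits on the support into - log p(r|u,z)
  plus the information density of (x, u), which gives the claim without \<open>\<epsilon>\<close>;
  smoothing the two laws costs \<open>\<epsilon> / 2\<close> each.\<close>

lemma single_letter_equiv_density:
  fixes P :: "('x::finite \<times> 'y::finite \<times> 'z::finite) pmf" and PR :: "nat \<Rightarrow> 'y \<Rightarrow> 'r::finite pmf"
  assumes b: "b > 1" and finU: "\<And>x. finite (set_pmf (PU x))" and \<epsilon>: "\<epsilon> > 0"
  defines "J \<equiv> single_letter_joint P PU PR"
  shows "\<exists>q1 q2. (\<forall>u z. pmf (q1 u) z > 0) \<and> (\<forall>v xy. pmf (q2 v) xy > 0) \<and>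
    measure_pmf.expectation J (equiv_density b P PR q1 q2)
      \<ge> cond_entropy_pmf b J (\<lambda>(x, y, z, u, r). r) (\<lambda>(x, y, z, u, r). (u, z))
        + mutual_info_pmf b J (\<lambda>(x, y, z, u, r). x) (\<lambda>(x, y, z, u, r). u) - \<epsilon>"
proof -
  let ?X = "\<lambda>(x :: 'x, y :: 'y, z :: 'z, u :: nat, r :: 'r). x"
  let ?U = "\<lambda>(x :: 'x, y :: 'y, z :: 'z, u :: nat, r :: 'r). u"
  let ?R = "\<lambda>(x :: 'x, y :: 'y, z :: 'z, u :: nat, r :: 'r). r"
  let ?UZ = "\<lambda>(x :: 'x, y :: 'y, z :: 'z, u :: nat, r :: 'r). (u, z)"
  let ?URZ = "\<lambda>(x :: 'x, y :: 'y, z :: 'z, u :: nat, r :: 'r). (u, r, z)"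
  let ?all = "\<lambda>(x :: 'x, y :: 'y, z :: 'z, u :: nat, r :: 'r). ((u, r, z), x, y)"
  \<comment> \<open>Chosen such that \<open>log b (1 - s) = - \<epsilon> / 2\<close>.\<close>
  define s where "s = 1 - b powr (- \<epsilon> / 2)"
  have "b powr (- \<epsilon> / 2) < b powr 0" using b \<epsilon> by (intro powr_less_mono) auto
  then have s: "0 < s" "s < 1" using b by (simp_all add: s_def)
  have log_s: "log b (1 - s) = - \<epsilon> / 2" using b by (simp add: s_def)
  have finJ: "finite (set_pmf J)" unfolding J_def by (rule finite_single_letter_joint[OF finU])
  have "map_pmf fst (map_pmf ?UZ J) = map_pmf ?U J" by (simp add: pmf.map_comp o_def case_prod_unfold)
  with ex_disintegration[of "map_pmf ?UZ J"] obtain k1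
    where k1: "map_pmf ?UZ J = joint_pmf (map_pmf ?U J) k1" by auto
  have "map_pmf fst (map_pmf ?all J) = map_pmf ?URZ J" by (simp add: pmf.map_comp o_def case_prod_unfold)
  with ex_disintegration[of "map_pmf ?all J"] obtain k2
    where k2: "map_pmf ?all J = joint_pmf (map_pmf ?URZ J) k2" by auto
  define q1 where "q1 = (\<lambda>u. smooth_pmf s (k1 u))"
  define q2 where "q2 = (\<lambda>v. smooth_pmf s (k2 v))"
  have "cond_entropy_pmf b J ?R ?UZ + mutual_info_pmf b J ?X ?U - \<epsilon>
    = measure_pmf.expectation J (\<lambda>v.
        - log b (pmf (map_pmf (\<lambda>v. (?R v, ?UZ v)) J) (?R v, ?UZ v) / pmf (map_pmf ?UZ J) (?UZ v))
        + log b (pmf (map_pmf (\<lambda>v. (?X v, ?U v)) J) (?X v, ?U v)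
            / (pmf (map_pmf ?X J) (?X v) * pmf (map_pmf ?U J) (?U v))) - \<epsilon>)"
    by (simp add: cond_entropy_pmf_eq[OF b] mutual_info_pmf_eq[OF b] expectation_diff[OF finJ]
        expectation_add[OF finJ])
  also have "\<dots> \<le> measure_pmf.expectation J (equiv_density b P PR q1 q2)"
  proof (intro expectation_mono finJ)
    fix v assume v: "v \<in> set_pmf J"
    obtain x y z u r where vv: "v = (x, y, z, u, r)" by (cases v)
    have Jv: "pmf J v = pmf P (x, y, z) * pmf (PU x) u * pmf (PR u y) r"
      by (simp add: vv J_def pmf_single_letter_joint)
    have pos: "pmf P (x, y, z) > 0" "pmf (PU x) u > 0" "pmf (PR u y) r > 0" "pmf (map_pmf fst P) x > 0"
      using v by (force simp: vv J_def set_single_letter_joint intro!: pmf_positive)+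
    have XU: "pmf (map_pmf (\<lambda>v. (?X v, ?U v)) J) (x, u) = pmf (map_pmf ?X J) x * pmf (PU x) u"
      using single_letter_marginals[of P PU PR] by (simp add: J_def case_prod_unfold pmf_joint_pmf)
    have UZ: "pmf (map_pmf ?UZ J) (u, z) = pmf (map_pmf ?U J) u * pmf (k1 u) z"
      unfolding k1 by (rule pmf_joint_pmf)
    have "inj ?all" by (auto simp: inj_def)
    then have "pmf J v = pmf (map_pmf ?all J) (?all v)" by (simp add: pmf_map_inj')
    also have "\<dots> = pmf (map_pmf ?URZ J) (u, r, z) * pmf (k2 (u, r, z)) (x, y)"
      unfolding k2 by (simp add: vv pmf_joint_pmf)
    finally have all: "pmf (map_pmf ?URZ J) (u, r, z) * pmf (k2 (u, r, z)) (x, y)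
        = pmf P (x, y, z) * pmf (PU x) u * pmf (PR u y) r"
      by (simp add: Jv)
    have "map_pmf (\<lambda>v. (?R v, ?UZ v)) J = map_pmf (\<lambda>(u, r, z). (r, u, z)) (map_pmf ?URZ J)"
      by (simp add: pmf.map_comp o_def case_prod_unfold)
    moreover have "inj (\<lambda>(u :: nat, r :: 'r, z :: 'z). (r, u, z))" by (auto simp: inj_def)
    ultimately have RUZ: "pmf (map_pmf (\<lambda>v. (?R v, ?UZ v)) J) (r, u, z) = pmf (map_pmf ?URZ J) (u, r, z)"
      using pmf_map_inj'[of "\<lambda>(u :: nat, r :: 'r, z :: 'z). (r, u, z)" "map_pmf ?URZ J" "(u, r, z)"]
      by simp
    have mpos: "pmf (map_pmf ?U J) u > 0" "pmf (map_pmf ?X J) x > 0" "pmf (map_pmf ?UZ J) (u, z) > 0"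
      "pmf (map_pmf ?URZ J) (u, r, z) > 0"
      using v by (force simp: vv intro!: pmf_positive)+
    have k1pos: "pmf (k1 u) z > 0" using mpos UZ by (simp add: zero_less_mult_iff)
    have "pmf (map_pmf ?URZ J) (u, r, z) * pmf (k2 (u, r, z)) (x, y) > 0"
      unfolding all using pos by simp
    then have k2pos: "pmf (k2 (u, r, z)) (x, y) > 0" using mpos by (simp add: zero_less_mult_iff)
    have "log b (pmf (map_pmf ?URZ J) (u, r, z)) + log b (pmf (k2 (u, r, z)) (x, y))
        = log b (pmf P (x, y, z) * pmf (PR u y) r) + log b (pmf (PU x) u)"
      using arg_cong[OF all, of "log b"] mpos k2pos pos b by (simp add: log_mult)
    moreover have "log b (pmf (q1 u) z) \<ge> log b (pmf (k1 u) z) - \<epsilon> / 2"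
      "log b (pmf (q2 (u, r, z)) (x, y)) \<ge> log b (pmf (k2 (u, r, z)) (x, y)) - \<epsilon> / 2"
      using log_pmf_smooth_pmf_ge[OF s b k1pos] log_pmf_smooth_pmf_ge[OF s b k2pos]
      by (simp_all add: q1_def q2_def log_s)
    moreover have "log b (pmf (map_pmf (\<lambda>v. (?R v, ?UZ v)) J) (?R v, ?UZ v) / pmf (map_pmf ?UZ J) (?UZ v))
        = log b (pmf (map_pmf ?URZ J) (u, r, z)) - log b (pmf (map_pmf ?U J) u) - log b (pmf (k1 u) z)"
      using mpos k1pos b by (simp add: vv RUZ UZ log_divide log_mult)
    moreover have "log b (pmf (map_pmf (\<lambda>v. (?X v, ?U v)) J) (?X v, ?U v)
            / (pmf (map_pmf ?X J) (?X v) * pmf (map_pmf ?U J) (?U v)))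
        = log b (pmf (PU x) u) - log b (pmf (map_pmf ?U J) u)"
      using mpos pos b by (simp add: vv XU log_divide)
    ultimately show "- log b (pmf (map_pmf (\<lambda>v. (?R v, ?UZ v)) J) (?R v, ?UZ v) / pmf (map_pmf ?UZ J) (?UZ v))
        + log b (pmf (map_pmf (\<lambda>v. (?X v, ?U v)) J) (?X v, ?U v)
            / (pmf (map_pmf ?X J) (?X v) * pmf (map_pmf ?U J) (?U v))) - \<epsilon>
        \<le> equiv_density b P PR q1 q2 v"
      unfolding equiv_density_def vv by simp
  qed
  finally show ?thesis
    by (intro exI[of _ q1] exI[of _ q2] conjI allI)
       (simp_all add: q1_def q2_def pmf_smooth_pmf_pos[OF s])
qed

lemma region_in_eve_causal_subset:
  fixes P :: "('x::finite \<times> 'y::finite \<times> 'z::finite) pmf" and F :: "'x \<Rightarrow> 'y \<Rightarrow> 'f"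
    and d :: "'f \<Rightarrow> 'r::finite \<Rightarrow> real"
  assumes b: "b > 1"
  shows "region_in_eve_causal b P F d \<subseteq> region_eve b P F d"
proof
  fix t assume "t \<in> region_in_eve_causal b P F d"
  then obtain R D E U PU PR where t: "t = (R, D, E)" and nonneg: "R \<ge> 0" "D \<ge> 0" "E \<ge> 0"
    and U: "finite (U :: nat set)" "\<And>x. set_pmf (PU x) \<subseteq> U"
    and R: "R \<ge> mutual_info_pmf b (single_letter_joint P PU PR) (\<lambda>(x, y, z, u, r). x) (\<lambda>(x, y, z, u, r). u)"
    and D: "D \<ge> measure_pmf.expectation (single_letter_joint P PU PR) (\<lambda>(x, y, z, u, r). d (F x y) r)"
    and E: "E \<le> cond_entropy_pmf b (single_letter_joint P PU PR) (\<lambda>(x, y, z, u, r). r) (\<lambda>(x, y, z, u, r). (u, z))"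
    unfolding region_in_eve_causal_def Let_def by blast
  define J where "J = single_letter_joint P PU PR"
  define I where "I = mutual_info_pmf b J (\<lambda>(x, y, z, u, r). x) (\<lambda>(x, y, z, u, r). u)"
  define p where "p = map_pmf fst P"
  define q where "q = joint_pmf p PU"
  obtain C where C: "P = joint_pmf p C" using ex_disintegration[of P] unfolding p_def ..
  have finU: "finite (set_pmf (PU x))" for x using U finite_subset by blast
  have finJ: "finite (set_pmf J)" unfolding J_def by (rule finite_single_letter_joint[OF finU])
  have finq: "finite (set_pmf q)" using finU by (simp add: q_def joint_pmf_def)
  have q1: "map_pmf fst q = p" by (simp add: q_def map_fst_joint_pmf)
  have qJ: "q = map_pmf (\<lambda>(x, y, z, u, r). (x, u)) J"
    by (simp add: q_def p_def J_def single_letter_marginals)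
  have Iq: "measure_pmf.expectation q (info_density b q) = I"
    unfolding I_def mutual_info_pmf_eq[OF b] qJ expectation_map_pmf info_density_def
    by (simp add: pmf.map_comp o_def case_prod_unfold)
  have I0: "I \<ge> 0" unfolding I_def by (rule mutual_info_pmf_nonneg[OF b finJ])
  have mean: "measure_pmf.expectation q (cond_mean C PR \<phi>) = measure_pmf.expectation J \<phi>" for \<phi>
    unfolding q_def J_def by (rule expectation_single_letter_joint[OF C, symmetric]) (rule finU)
  have "achievable b P F d R D E"
    unfolding achievable_def
  proof (intro allI impI)
    fix \<delta> :: real assume \<delta>: "\<delta> > 0"
    \<comment> \<open>The equivocation loses \<open>\<delta> / 2\<close> by smoothing,
      \<open>\<delta> / 4\<close> by typicality and \<open>\<delta> / 4\<close> by the codebook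
      rate.\<close>
    have half: "\<delta> / 2 > 0" using \<delta> by simp
    obtain k1 k2 where k: "\<And>u z. pmf (k1 u) z > 0" "\<And>v xy. pmf (k2 v) xy > 0"
      and "measure_pmf.expectation (single_letter_joint P PU PR) (equiv_density b P PR k1 k2)
        \<ge> cond_entropy_pmf b (single_letter_joint P PU PR) (\<lambda>(x, y, z, u, r). r) (\<lambda>(x, y, z, u, r). (u, z))
          + mutual_info_pmf b (single_letter_joint P PU PR) (\<lambda>(x, y, z, u, r). x) (\<lambda>(x, y, z, u, r). u)
          - \<delta> / 2"
      using single_letter_equiv_density[OF b, of PU "\<delta> / 2" P PR, OF finU half] by blast
    then have eq: "measure_pmf.expectation J (equiv_density b P PR k1 k2)
        \<ge> cond_entropy_pmf b J (\<lambda>(x, y, z, u, r). r) (\<lambda>(x, y, z, u, r). (u, z)) + I - \<delta> / 2"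
      unfolding J_def I_def by simp
    define gd where "gd = cond_mean C PR (\<lambda>(x, y, z, u, r). d (F x y) r)"
    \<comment> \<open>Negated, because the covering bounds averages from above while the
      equivocation needs a lower bound.\<close>
    define ge where "ge = (\<lambda>v. - cond_mean C PR (equiv_density b P PR k1 k2) v)"
    have "\<delta> / 4 > 0" using \<delta> by simp
    then
    \<comment> \<open>The codebook has rate about \<open>I\<close> rather than \<open>R\<close>:
      each unit of log M is lost from the equivocation bound, and only \<open>I\<close> is
      compensated by the mean of the density.\<close>
    have "\<forall>\<^sub>F n in sequentially. \<exists>M cb f. 0 < M \<and> log b (real M) \<le> real n * (I + \<delta> / 4) \<and>
      (\<forall>xs. f xs < M) \<and>
      (\<forall>g\<in>{gd, ge}. (\<Sum>i<n. measure_pmf.expectation (replicate_pmf n p)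
        (\<lambda>xs. g (xs ! i, cb (f xs) ! i))) \<le> real n * (measure_pmf.expectation q g + \<delta> / 4))"
      by (rule covering[OF b finq _ I0 Iq[THEN eq_refl], unfolded q1, rotated]) simp
    then show "\<forall>\<^sub>F n in sequentially. \<exists>c :: ('x, 'y, 'r) code. is_code n c \<and>
        1 / real n * log b (real (card (msgs c))) \<le> R + \<delta> \<and>
        code_distortion P F d n c \<le> D + \<delta> \<and> code_equivocation b P n c \<ge> E - \<delta>"
      using eventually_gt_at_top[of 0]
    proof eventually_elim
      case (elim n)
      then obtain M cb f where M: "0 < M" "log b (real M) \<le> real n * (I + \<delta> / 4)"
        and f: "\<And>xs. f xs < M"
        and gd: "(\<Sum>i<n. measure_pmf.expectation (replicate_pmf n p) (\<lambda>xs. gd (xs ! i, cb (f xs) ! i)))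
          \<le> real n * (measure_pmf.expectation q gd + \<delta> / 4)"
        and ge: "(\<Sum>i<n. measure_pmf.expectation (replicate_pmf n p) (\<lambda>xs. ge (xs ! i, cb (f xs) ! i)))
          \<le> real n * (measure_pmf.expectation q ge + \<delta> / 4)"
        by blast
      have n: "n > 0" using elim by simp
      let ?c = "codebook_code M f cb PR"
      have "is_code n ?c" using f by (simp add: is_code_def codebook_code_def)
      moreover have "1 / real n * log b (real (card (msgs ?c))) \<le> R + \<delta>"
      proof -
        have "log b (real M) / real n \<le> I + \<delta> / 4" using M n by (simp add: field_simps)
        then show ?thesis using R \<delta> by (simp add: codebook_code_def I_def J_def)
      qed
      moreover have "code_distortion P F d n ?c \<le> D + \<delta>"
      proof -
        have "measure_pmf.expectation (code_joint P n ?c)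
            (\<lambda>(xs, ys, zs, w, rs). \<Sum>i<n. d (F (xs ! i) (ys ! i)) (rs ! i))
          = (\<Sum>i<n. measure_pmf.expectation (replicate_pmf n p) (\<lambda>xs. gd (xs ! i, cb (f xs) ! i)))"
          using expectation_codebook_code[OF C[unfolded p_def], of n M f cb PR "\<lambda>(x, y, z, u, r). d (F x y) r"]
          by (simp add: p_def gd_def)
        then have "code_distortion P F d n ?c
            = (\<Sum>i<n. measure_pmf.expectation (replicate_pmf n p) (\<lambda>xs. gd (xs ! i, cb (f xs) ! i))) / real n"
          by (simp add: code_distortion_def distortion_def case_prod_unfold)
        also have "\<dots> \<le> measure_pmf.expectation q gd + \<delta> / 4"
          using gd n by (simp add: field_simps)
        also have "\<dots> \<le> D + \<delta>" using D \<delta> by (simp add: gd_def mean J_def)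
        finally show ?thesis .
      qed
      moreover have "code_equivocation b P n ?c \<ge> E - \<delta>"
      proof -
        have "(\<Sum>i<n. measure_pmf.expectation (replicate_pmf n p) (\<lambda>xs. ge (xs ! i, cb (f xs) ! i)))
          = - measure_pmf.expectation (code_joint P n ?c) (\<lambda>(xs, ys, zs, w, rs).
              \<Sum>i<n. equiv_density b P PR k1 k2 (xs ! i, ys ! i, zs ! i, cb w ! i, rs ! i))"
          using expectation_codebook_code[OF C[unfolded p_def], of n M f cb PR "equiv_density b P PR k1 k2"]
          by (simp add: p_def ge_def sum_negf)
        moreover have lower: "measure_pmf.expectation (code_joint P n ?c) (\<lambda>(xs, ys, zs, w, rs).
              \<Sum>i<n. equiv_density b P PR k1 k2 (xs ! i, ys ! i, zs ! i, cb w ! i, rs ! i)) - log b (real M)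
            \<le> cond_entropy_pmf b (code_joint P n ?c) (\<lambda>(xs, ys, zs, w, rs). rs) (\<lambda>(xs, ys, zs, w, rs). (w, zs))"
          by (rule codebook_equivocation_ge[OF b M(1)]) (use f k in auto)
        moreover have "measure_pmf.expectation q ge = - measure_pmf.expectation J (equiv_density b P PR k1 k2)"
          by (simp add: ge_def mean)
        ultimately have "real n * (measure_pmf.expectation J (equiv_density b P PR k1 k2) - \<delta> / 4)
            - real n * (I + \<delta> / 4)
          \<le> cond_entropy_pmf b (code_joint P n ?c) (\<lambda>(xs, ys, zs, w, rs). rs) (\<lambda>(xs, ys, zs, w, rs). (w, zs))"
          using lower ge M(2)
          by (simp add: algebra_simps)
        moreover have "real n * (E - \<delta>) \<le> real n * (measure_pmf.expectation J (equiv_density b P PR k1 k2) - \<delta> / 4)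
            - real n * (I + \<delta> / 4)"
          unfolding right_diff_distrib[symmetric]
          using eq E by (intro mult_left_mono) (auto simp: J_def)
        ultimately show ?thesis
          using n by (simp add: code_equivocation_def field_simps)
      qed
      ultimately show ?case by blast
    qed
  qed
  with nonneg show "t \<in> region_eve b P F d" by (simp add: region_eve_def t)
qed

theorem proposition3:
  fixes b :: real
    and P :: "('x::finite \<times> 'y::finite \<times> 'z::finite) pmf"
    and F :: "'x \<Rightarrow> 'y \<Rightarrow> 'f"
    and d :: "'f \<Rightarrow> 'r::finite \<Rightarrow> real"
  assumes "b > 1"
    and "\<And>v r. d v r \<ge> 0"
  shows "region_eve b P F d = region_in_eve_causal b P F d"
  using region_eve_subset[OF assms(1)] region_in_eve_causal_subset[OF assms(1)] by blast

end
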